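(* Let $F\colon \mathbb{R}^n \to \mathbb{R}^m$ be $\mathcal{C}^2$, let $g\colon \mathbb{R}^m \to \mathbb{R}$ be convex and finite valued, let $D \subset \mathbb{R}^n$ be convex and closed, and assume that $F$, $g$ and $D$ are definable in the same o-minimal structure on the field of real numbers. Let $x_0 \in D$, $\mu_0 > 0$, $\tau > 1$, and let $\{x_k\}_{k\in\mathbb{N}}$, $\{\mu_k\}_{k\in\mathbb{N}}$ be the sequences generated by the composite Gauss-Newton algorithm (described in the context) for the problem $\min_{x \in D} g(F(x))$. Then one of the following alternatives holds as $k \to +\infty$: (i) $\|x_k\| \to +\infty$; (ii) $x_k$ converges to a critical point of the problem $\min_{x\in D} g(F(x))$, the sequence $\{\|x_{k+1}-x_k\|\}_{k\in\mathbb{N}}$ is summable, and $\{\mu_k\}_{k\in\mathbb{N}}$ is bounded.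
   Context: $\|\cdot\|$ is the Euclidean norm, and $\nabla F(x) = \left[\frac{\partial f_i}{\partial x_j}(x)\right] \in \mathbb{R}^{m\times n}$ is the Jacobian matrix of $F = (f_1,\ldots,f_m)$ at $x$. Definability: an o-minimal structure on the field of real numbers is a family $(\mathcal{O}_p)_{p\ge 1}$, where $\mathcal{O}_p$ is a Boolean algebra of subsets of $\mathbb{R}^p$, stable under Cartesian products and under coordinate projections $\mathbb{R}^{p+1}\to\mathbb{R}^p$, containing all real algebraic subsets, and such that the elements of $\mathcal{O}_1$ are exactly the finite unions of points and open intervals. Sets belonging to the structure are called definable; a function is definable if its graph is definable. One such structure is fixed throughout (for instance, the semi-algebraic sets). Composite Gauss-Newton algorithm: given $x_0\in D$, $\mu_0>0$, $\tau>1$, for each $k = 0,1,2,\ldots$ do the following. Step 1. Set $\mu_k = \mu_0$ and compute the candidate iterate $$\tilde{x}_{k+1} = \operatorname{argmin}_{y\in D}\; g\big(F(x_k) + \nabla F(x_k)(y - x_k)\big) + \frac{\mu_k}{2}\|y-x_k\|^2$$ (the minimizer exists and is unique by strong convexity). Step 2. While $g(F(\tilde{x}_{k+1})) > g\big(F(x_k) + \nabla F(x_k)(\tilde{x}_{k+1} - x_k)\big) + \frac{\mu_k}{2}\|\tilde{x}_{k+1}-x_k\|^2$, replace $\mu_k$ by $\tau\mu_k$ and recompute $\tilde{x}_{k+1}$ as the argmin of Step 1 with the new value of $\mu_k$. Step 3. Set $x_{k+1} = \tilde{x}_{k+1}$. Here $\mu_k$ (for each iteration $k$) denotes the final value obtained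 upon exit of the while loop at iteration $k$. Critical point: a point $x\in D$ such that $0$ belongs to the limiting subdifferential at $x$ of $g\circ F + i_D$, where $i_D$ is the indicator function of $D$ ($0$ on $D$, $+\infty$ elsewhere); equivalently, there exists $v\in\partial g(F(x))$ with $-\nabla F(x)^T v \in N_D(x)$, where $N_D(x)$ is the normal cone to $D$ at $x$. *)

theory Defs
  imports "HOL-Analysis.Analysis" "HOL-Library.While_Combinator"
begin

section \<open>O-minimal structures on the real field\<close>

text \<open>Since all dimensions have to be available at once, points of the space of dimension
  \<open>p\<close> are represented by real lists of length \<open>p\<close>.\<close>

inductive polynomial_fun :: "nat \<Rightarrow> (real list \<Rightarrow> real) \<Rightarrow> bool" for p :: nat where
  const: "polynomial_fun p (\<lambda>_. c)"
| coord: "i < p \<Longrightarrow> polynomial_fun p (\<lambda>xs. xs ! i)"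
| add: "polynomial_fun p q \<Longrightarrow> polynomial_fun p r \<Longrightarrow> polynomial_fun p (\<lambda>xs. q xs + r xs)"
| mult: "polynomial_fun p q \<Longrightarrow> polynomial_fun p r \<Longrightarrow> polynomial_fun p (\<lambda>xs. q xs * r xs)"

definition real_algebraic_set :: "nat \<Rightarrow> real list set \<Rightarrow> bool" where
  "real_algebraic_set p A \<longleftrightarrow>
     (\<exists>Q. finite Q \<and> (\<forall>q\<in>Q. polynomial_fun p q) \<and>
          A = {xs. length xs = p \<and> (\<forall>q\<in>Q. q xs = 0)})"

text \<open>\<open>S p\<close> is the collection of definable subsets of the space of dimension \<open>p \<ge> 1\<close>;
  \<open>S 0\<close> is irrelevant. The open intervals may be unbounded.\<close>

locale o_minimal_structure =
  fixes S :: "nat \<Rightarrow> real list set set"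
  assumes boolean_algebra: "p \<ge> 1 \<Longrightarrow> algebra {xs. length xs = p} (S p)"
    and cartesian_product:
      "p \<ge> 1 \<Longrightarrow> q \<ge> 1 \<Longrightarrow> A \<in> S p \<Longrightarrow> B \<in> S q \<Longrightarrow> {xs @ ys |xs ys. xs \<in> A \<and> ys \<in> B} \<in> S (p + q)"
    and projection: "p \<ge> 1 \<Longrightarrow> A \<in> S (p + 1) \<Longrightarrow> butlast ` A \<in> S p"
    and algebraic: "p \<ge> 1 \<Longrightarrow> real_algebraic_set p A \<Longrightarrow> A \<in> S p"
    and dimension_one:
      "S 1 = {(\<lambda>t. [t]) ` (P \<union> \<Union>\<I>) |P \<I>.
                finite P \<and> finite \<I> \<and> (\<forall>I\<in>\<I>. open I \<and> is_interval I)}"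

text \<open>Coordinates with respect to an arbitrary but fixed enumeration of the standard basis.
  The order is immaterial for definability: an o-minimal structure is stable under permutations
  of coordinates, as follows from the axioms for products, projections and algebraic sets.\<close>

definition basis_list :: "'a::euclidean_space list" where
  "basis_list = (SOME bs. distinct bs \<and> set bs = Basis)"

definition coords :: "'a::euclidean_space \<Rightarrow> real list" where
  "coords x = map (\<lambda>b. x \<bullet> b) basis_list"

definition definable_set :: "(nat \<Rightarrow> real list set set) \<Rightarrow> 'a::euclidean_space set \<Rightarrow> bool" where
  "definable_set S A \<longleftrightarrow> coords ` A \<in> S DIM('a)"

definition definable_fun ::
  "(nat \<Rightarrow> real list set set) \<Rightarrow> ('a::euclidean_space \<Rightarrow> 'b::euclidean_space) \<Rightarrow> bool" where
  "definable_fun S f \<longleftrightarrow> range (\<lambda>x. coords x @ coords (f x)) \<in> S (DIM('a) + DIM('b))"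


section \<open>Twice continuously differentiable maps\<close>

definition C2 :: "('a::real_normed_vector \<Rightarrow> 'b::real_normed_vector) \<Rightarrow> bool" where
  "C2 f \<longleftrightarrow>
     (\<exists>(f' :: 'a \<Rightarrow> 'a \<Rightarrow>\<^sub>L 'b) (f'' :: 'a \<Rightarrow> 'a \<Rightarrow>\<^sub>L 'a \<Rightarrow>\<^sub>L 'b).
        (\<forall>x. (f has_derivative blinfun_apply (f' x)) (at x)) \<and>
        (\<forall>x. (f' has_derivative blinfun_apply (f'' x)) (at x)) \<and>
        continuous_on UNIV f'')"


section \<open>Limiting subdifferential and critical points\<close>

definition frechet_subdifferential :: "('a::euclidean_space \<Rightarrow> ereal) \<Rightarrow> 'a \<Rightarrow> 'a set" where
  "frechet_subdifferential h x =
     {v. \<bar>h x\<bar> \<noteq> \<infinity> \<and>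
         0 \<le> Liminf (at x) (\<lambda>y. (h y - h x - ereal (v \<bullet> (y - x))) / ereal (norm (y - x)))}"

definition limiting_subdifferential :: "('a::euclidean_space \<Rightarrow> ereal) \<Rightarrow> 'a \<Rightarrow> 'a set" where
  "limiting_subdifferential h x =
     {v. \<bar>h x\<bar> \<noteq> \<infinity> \<and>
         (\<exists>u w. u \<longlonglongrightarrow> x \<and> (\<lambda>k. h (u k)) \<longlonglongrightarrow> h x \<and>
                (\<forall>k. w k \<in> frechet_subdifferential h (u k)) \<and> w \<longlonglongrightarrow> v)}"

text \<open>The convex-analytic indicator, as opposed to the characteristic function
  \<^const>\<open>indicator\<close>.\<close>

definition indicator_inf :: "'a set \<Rightarrow> 'a \<Rightarrow> ereal" where
  "indicator_inf D x = (if x \<in> D then 0 else \<infinity>)"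

definition critical_point ::
  "('a::euclidean_space \<Rightarrow> 'b) \<Rightarrow> ('b \<Rightarrow> real) \<Rightarrow> 'a set \<Rightarrow> 'a \<Rightarrow> bool" where
  "critical_point F g D x \<longleftrightarrow>
     x \<in> D \<and> 0 \<in> limiting_subdifferential (\<lambda>y. ereal (g (F y)) + indicator_inf D y) x"


section \<open>The composite Gauss-Newton algorithm\<close>

definition gn_model ::
  "(real^'n \<Rightarrow> real^'m) \<Rightarrow> (real^'m \<Rightarrow> real) \<Rightarrow> real^'n \<Rightarrow> real \<Rightarrow> real^'n \<Rightarrow> real" where
  "gn_model F g x \<mu> y =
     g (F x + jacobian F (at x) *v (y - x)) + \<mu> / 2 * (norm (y - x))\<^sup>2"

definition gn_candidate ::
  "(real^'n \<Rightarrow> real^'m) \<Rightarrow> (real^'m \<Rightarrow> real) \<Rightarrow> (real^'n) set \<Rightarrow> real^'n \<Rightarrow> real \<Rightarrow> real^'n" where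
  "gn_candidate F g D x \<mu> = arg_min (gn_model F g x \<mu>) (\<lambda>y. y \<in> D)"

definition gn_parameter ::
  "(real^'n \<Rightarrow> real^'m) \<Rightarrow> (real^'m \<Rightarrow> real) \<Rightarrow> (real^'n) set \<Rightarrow> real \<Rightarrow> real \<Rightarrow> real^'n \<Rightarrow> real" where
  "gn_parameter F g D \<mu>\<^sub>0 \<tau> x =
     while (\<lambda>\<mu>. g (F (gn_candidate F g D x \<mu>)) > gn_model F g x \<mu> (gn_candidate F g D x \<mu>))
       (\<lambda>\<mu>. \<tau> * \<mu>) \<mu>\<^sub>0"

definition gauss_newton_sequences ::
  "(real^'n \<Rightarrow> real^'m) \<Rightarrow> (real^'m \<Rightarrow> real) \<Rightarrow> (real^'n) set \<Rightarrow> real \<Rightarrow> real \<Rightarrow> real^'n \<Rightarrow>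
   (nat \<Rightarrow> real^'n) \<Rightarrow> (nat \<Rightarrow> real) \<Rightarrow> bool" where
  "gauss_newton_sequences F g D \<mu>\<^sub>0 \<tau> x\<^sub>0 x \<mu> \<longleftrightarrow>
     x 0 = x\<^sub>0 \<and>
     (\<forall>k. \<mu> k = gn_parameter F g D \<mu>\<^sub>0 \<tau> (x k) \<and>
          x (Suc k) = gn_candidate F g D (x k) (\<mu> k))"

end

theory Submission
  imports Defs
begin

text \<open>Write \<open>V(x, \<mu>)\<close> for the minimum over \<open>D\<close> of the model \<open>g
  (F x + F'(x) (y - x)) + \<mu>/2 \<parallel>y - x\<parallel>\<^sup>2\<close>, and \<open>\<sigma>(x,
  \<mu>)\<close> for the distance from \<open>x\<close> to the minimizer. A model step decreases the
  value: \<open>V\<close> is at most \<open>g (F x) - \<mu>/4 \<sigma>\<^sup>2\<close> by convexity, and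
  the loop of the algorithm stops as soon as \<open>g (F x\<^bsub>k+1\<^esub>) \<le> V(x\<^sub>k,
  \<mu>\<^sub>k)\<close>. Hence the numbers \<open>v\<^sub>k = V(x\<^sub>k, \<mu>\<^sub>k)\<close>
  decrease and \<open>v\<^sub>k - v\<^bsub>k+1\<^esub>\<close> dominates a multiple of
  \<open>\<sigma>\<^bsub>k+1\<^esub>\<^sup>2\<close>. If the norms of the iterates do not tend to
  infinity, there is a cluster point \<open>c\<close>, the \<open>v\<^sub>k\<close> decrease to \<open>w
  = g (F c)\<close>, and the steps tend to 0. The remaining question is why the total length of the path
  is finite.

  The value function answers it, because it is smoother than \<open>g \<circ> F\<close>: comparing two
  models at the same trial point gives \<open>V(x', \<mu>') - V(x, \<mu>) \<le> C (\<sigma>(x, \<mu>) e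
  + e\<^sup>2)\<close>, where \<open>e\<close> is the distance of \<open>(x, \<mu>)\<close> and
  \<open>(x', \<mu>')\<close> (\<open>model_slope\<close>). So \<open>\<sigma>\<close> bounds the slope
  of \<open>V\<close>. Now choose on every level \<open>V = r\<close> near \<open>c\<close>, with
  \<open>r > w\<close>, a point \<open>\<gamma> r\<close> where \<open>\<sigma>\<close> is smallest.
  This choice can be made definably, and by o-minimality the coordinates of \<open>\<gamma>\<close> and
  the minimal value \<open>\<sigma> (\<gamma> r)\<close> are then monotone for \<open>r\<close> close to
  \<open>w\<close>. Since the steps tend to 0, the minimal value cannot grow as \<open>r\<close>
  decreases to \<open>w\<close>; since the coordinates are bounded, \<open>\<gamma>\<close> has finite
  length. Let \<open>s r\<close> be the length measured in the 1-norm, up to a constant. As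
  \<open>V\<close> increases by \<open>t - r\<close> between \<open>\<gamma> r\<close> and
  \<open>\<gamma> t\<close>, the slope bound on ever finer subdivisions yields \<open>t - r \<le> C
  \<sigma> (s t - s r)\<close>, where \<open>\<sigma>\<close> is the value at any point of level
  \<open>t\<close> (\<open>definable_desingularization\<close>). This is an integrated form of the
  Kurdyka-Lojasiewicz inequality, with the monotone but possibly discontinuous \<open>s\<close> as
  desingularizing function.

  Together, \<open>\<sigma>\<^bsub>k+1\<^esub>\<^sup>2 \<le> K \<sigma>\<^sub>k (s v\<^sub>k - s
  v\<^bsub>k+1\<^esub>)\<close> as long as \<open>x\<^sub>k\<close> is near \<open>c\<close>, whence the
  steps are summable and the iterates stay near \<open>c\<close> and converge to it
  (\<open>finite_length_convergence\<close>). The parameters are bounded because those accepted on a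
  bounded set are bounded (\<open>gn_parameter_bounds\<close>), and in the limit \<open>c\<close>
  minimizes its own model, which makes it critical (\<open>critical_point_if_model_minimizer\<close>).

  The only consequence of o-minimality in one variable that enters is that a definable property of reals
  holds throughout, or fails throughout, some interval to the right of a given point
  (\<open>definable_pred_germ\<close>).\<close>

section \<open>Coordinates and definable sets in Euclidean spaces\<close>

lemma basis_list: "distinct (basis_list :: 'a::euclidean_space list)" "set (basis_list :: 'a list) = Basis"
proof -
  have "\<exists>bs :: 'a list. distinct bs \<and> set bs = Basis"
    using finite_distinct_list[OF finite_Basis] by auto
  then show "distinct (basis_list :: 'a::euclidean_space list)" "set (basis_list :: 'a list) = Basis"
    unfolding basis_list_def by (metis (mono_tags, lifting) someI_ex)+
qed

lemma length_basis_list: "length (basis_list :: 'a::euclidean_space list) = DIM('a)"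
  using distinct_card[OF basis_list(1)] by (metis basis_list(2))

lemma length_coords [simp]: "length (coords (x :: 'a::euclidean_space)) = DIM('a)"
  by (simp add: coords_def length_basis_list)

lemma coords_nth: "i < DIM('a) \<Longrightarrow> coords (x :: 'a::euclidean_space) ! i = x \<bullet> basis_list ! i"
  by (simp add: coords_def length_basis_list)

lemma basis_list_nth: "i < DIM('a) \<Longrightarrow> (basis_list :: 'a::euclidean_space list) ! i \<in> Basis"
  using basis_list(2) length_basis_list by (metis nth_mem)

lemma Basis_nthE:
  assumes "(b :: 'a::euclidean_space) \<in> Basis"
  obtains i where "i < DIM('a)" "basis_list ! i = b"
  using assms basis_list(2) length_basis_list by (metis in_set_conv_nth)

lemma coords_inject [simp]: "coords (x :: 'a::euclidean_space) = coords y \<longleftrightarrow> x = y"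
proof
  assume eq: "coords x = coords y"
  show "x = y"
  proof (rule euclidean_eqI)
    fix b :: 'a assume "b \<in> Basis"
    then obtain i where "i < DIM('a)" "basis_list ! i = b" by (rule Basis_nthE)
    then show "x \<bullet> b = y \<bullet> b" using coords_nth eq by metis
  qed
qed simp

lemma coords_surj:
  fixes xs :: "real list"
  assumes "length xs = DIM('a)"
  obtains x :: "'a::euclidean_space" where "coords x = xs"
proof -
  have "\<forall>b::'a. \<exists>i. b \<in> Basis \<longrightarrow> i < DIM('a) \<and> basis_list ! i = b"
    using Basis_nthE by metis
  then obtain idx where idx: "\<And>b::'a. b \<in> Basis \<Longrightarrow> idx b < DIM('a) \<and> basis_list ! idx b = b"
    by metis
  define x :: 'a where "x = (\<Sum>b\<in>Basis. (xs ! idx b) *\<^sub>R b)"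
  have "coords x ! i = xs ! i" if i: "i < DIM('a)" for i
  proof -
    let ?b = "basis_list ! i :: 'a"
    have b: "?b \<in> Basis" by (rule basis_list_nth[OF i])
    have "idx ?b = i"
      using idx[OF b] i basis_list(1) length_basis_list by (metis nth_eq_iff_index_eq)
    then show ?thesis
      using b i by (simp add: coords_nth x_def)
  qed
  then have "coords x = xs" by (intro nth_equalityI) (simp_all add: assms)
  then show ?thesis by (rule that)
qed

context o_minimal_structure
begin

lemma S_length: "p \<ge> 1 \<Longrightarrow> A \<in> S p \<Longrightarrow> xs \<in> A \<Longrightarrow> length xs = p"
  using algebra.axioms(1)[OF boolean_algebra, of p] by (auto simp: ring_of_sets_def semiring_of_sets_def subset_class_def)

lemma S_Int: "p \<ge> 1 \<Longrightarrow> A \<in> S p \<Longrightarrow> B \<in> S p \<Longrightarrow> A \<inter> B \<in> S p"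
  using boolean_algebra[of p] by (metis algebra.axioms(1) semiring_of_sets.Int ring_of_sets.axioms(1))

lemma S_space: "p \<ge> 1 \<Longrightarrow> {xs. length xs = p} \<in> S p"
  using boolean_algebra[of p] by (simp add: algebra.top)

lemma S_compl: "p \<ge> 1 \<Longrightarrow> A \<in> S p \<Longrightarrow> {xs. length xs = p} - A \<in> S p"
  using boolean_algebra[of p] by (simp add: algebra.compl_sets)

lemma projection_take:
  assumes "p \<ge> 1" "A \<in> S (p + n)"
  shows "take p ` A \<in> S p"
  using assms(2)
proof (induction n arbitrary: A)
  case 0
  have "take p xs = xs" if "xs \<in> A" for xs
    using S_length[of p A xs] 0 assms(1) that by simp
  then have "take p ` A = A" by force
  with 0 show ?case by simp
next
  case (Suc n)
  have len: "length xs = Suc (p + n)" if "xs \<in> A" for xs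
    using S_length[of "p + Suc n" A xs] Suc.prems assms(1) that by simp
  have "butlast ` A \<in> S (p + n)"
    using projection[of "p + n" A] Suc.prems assms(1) by simp
  then have "take p ` butlast ` A \<in> S p" by (rule Suc.IH)
  also have "take p ` butlast ` A = take p ` A"
    unfolding image_image using len by (intro image_cong) (auto simp: take_butlast)
  finally show ?case .
qed

text \<open>The preimage is a projection of the graph of the coordinate map, which is cut out of a product by finitely many linear
  equations. Permutations of coordinates are the case \<open>p = q\<close>.\<close>

lemma reindex:
  assumes p: "p \<ge> 1" and q: "q \<ge> 1" and A: "A \<in> S p" and j: "\<And>i. i < p \<Longrightarrow> j i < q"
  shows "{xs. length xs = q \<and> map (\<lambda>i. xs ! j i) [0..<p] \<in> A} \<in> S q"
proof -
  define Q :: "(real list \<Rightarrow> real) set" where "Q = (\<lambda>i zs. zs ! (q + i) + (- 1) * zs ! j i) ` {..<p}"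
  define E where "E = {zs. length zs = q + p \<and> (\<forall>h\<in>Q. h zs = 0)}"
  have "polynomial_fun (q + p) h" if "h \<in> Q" for h
  proof -
    from that obtain i where i: "i < p" "h = (\<lambda>zs. zs ! (q + i) + (- 1) * zs ! j i)"
      by (auto simp: Q_def)
    show ?thesis unfolding i(2)
      using i(1) j[OF i(1)] by (intro polynomial_fun.intros) auto
  qed
  moreover have fin: "finite Q" by (simp add: Q_def)
  ultimately have E: "E \<in> S (q + p)"
    using q unfolding E_def
    by (intro algebraic) (auto simp only: real_algebraic_set_def fin intro!: exI[of _ Q])
  let ?P = "{xs @ ys |xs ys. xs \<in> {xs. length xs = q} \<and> ys \<in> A}"
  have "take q ` (?P \<inter> E) \<in> S q"
    using p q A E by (intro projection_take S_Int cartesian_product S_space) auto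
  also have "take q ` (?P \<inter> E) = {xs. length xs = q \<and> map (\<lambda>i. xs ! j i) [0..<p] \<in> A}"
  proof (intro equalityI subsetI)
    fix zs assume "zs \<in> take q ` (?P \<inter> E)"
    then obtain xs ys where *: "length xs = q" "ys \<in> A" "xs @ ys \<in> E" "zs = xs" by auto
    have len: "length ys = p" using S_length[OF p A] * by simp
    have "ys ! i = xs ! j i" if "i < p" for i
      using *(1,3) that j[OF that] by (auto simp: E_def Q_def nth_append)
    then have "map (\<lambda>i. xs ! j i) [0..<p] = ys"
      using len by (intro nth_equalityI) auto
    then show "zs \<in> {xs. length xs = q \<and> map (\<lambda>i. xs ! j i) [0..<p] \<in> A}" using * by simp
  next
    fix xs assume xs: "xs \<in> {xs. length xs = q \<and> map (\<lambda>i. xs ! j i) [0..<p] \<in> A}"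
    let ?ys = "map (\<lambda>i. xs ! j i) [0..<p]"
    have "xs @ ?ys \<in> E" using xs j by (auto simp: E_def Q_def nth_append)
    moreover have "xs @ ?ys \<in> ?P" using xs by blast
    ultimately have "xs @ ?ys \<in> ?P \<inter> E" by (rule IntI[rotated])
    moreover have "xs = take q (xs @ ?ys)" using xs by simp
    ultimately show "xs \<in> take q ` (?P \<inter> E)" by (rule image_eqI[rotated])
  qed
  finally show ?thesis .
qed

lemma change_coordinates:
  fixes e\<^sub>1 e\<^sub>2 :: "'c \<Rightarrow> real list"
  assumes p: "p \<ge> 1" and A: "e\<^sub>1 ` A \<in> S p"
    and len: "\<And>x. length (e\<^sub>1 x) = p" "\<And>x. length (e\<^sub>2 x) = p"
    and inj: "\<And>x y. e\<^sub>1 x = e\<^sub>1 y \<Longrightarrow> x = y"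
    and surj: "\<And>xs. length xs = p \<Longrightarrow> \<exists>x. e\<^sub>2 x = xs"
    and perm: "\<And>i. i < p \<Longrightarrow> \<exists>j<p. \<forall>x. e\<^sub>1 x ! i = e\<^sub>2 x ! j"
  shows "e\<^sub>2 ` A \<in> S p"
proof -
  from perm obtain j where j: "\<And>i. i < p \<Longrightarrow> j i < p" "\<And>i x. i < p \<Longrightarrow> e\<^sub>1 x ! i = e\<^sub>2 x ! j i"
    by metis
  have eq: "map (\<lambda>i. e\<^sub>2 x ! j i) [0..<p] = e\<^sub>1 x" for x
    using j(2) len(1) by (intro nth_equalityI) auto
  have "{xs. length xs = p \<and> map (\<lambda>i. xs ! j i) [0..<p] \<in> e\<^sub>1 ` A} = e\<^sub>2 ` A"
  proof (intro equalityI subsetI)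
    fix xs assume xs: "xs \<in> {xs. length xs = p \<and> map (\<lambda>i. xs ! j i) [0..<p] \<in> e\<^sub>1 ` A}"
    then obtain x where x: "e\<^sub>2 x = xs" using surj by blast
    then have "e\<^sub>1 x \<in> e\<^sub>1 ` A" using xs eq[of x] by simp
    then show "xs \<in> e\<^sub>2 ` A" using inj x by blast
  qed (use eq len in auto)
  then show ?thesis using reindex[OF p p A, of j] j(1) by simp
qed

text \<open>The basis of a product space is enumerated in an arbitrary order, so that its coordinates are only a permutation of
  the concatenated coordinates of the factors.\<close>

lemma definable_set_prod_iff:
  fixes A :: "('a::euclidean_space \<times> 'b::euclidean_space) set"
  shows "definable_set S A \<longleftrightarrow> (\<lambda>(x, y). coords x @ coords y) ` A \<in> S (DIM('a) + DIM('b))"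
proof -
  let ?e = "\<lambda>(x :: 'a, y :: 'b). coords x @ coords y"
  let ?p = "DIM('a) + DIM('b)"
  have p: "?p \<ge> 1" using DIM_positive[where 'a='a] by linarith
  have surj: "\<exists>z. ?e z = xs" if len: "length xs = ?p" for xs
  proof -
    obtain x :: 'a where x: "coords x = take DIM('a) xs"
      by (rule coords_surj[of "take DIM('a) xs"]) (use len in auto)
    obtain y :: 'b where y: "coords y = drop DIM('a) xs"
      by (rule coords_surj[of "drop DIM('a) xs"]) (use len in auto)
    have "?e (x, y) = xs" using x y by simp
    then show ?thesis by blast
  qed
  have surj': "\<exists>z :: 'a \<times> 'b. coords z = xs" if "length xs = ?p" for xs
    using that coords_surj[where 'a="'a \<times> 'b" and xs=xs] by (metis DIM_prod)
  have 1: "\<exists>j<?p. \<forall>z. coords z ! i = ?e z ! j" if i: "i < ?p" for i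
  proof -
    have "(basis_list ! i :: 'a \<times> 'b) \<in> Basis" using basis_list_nth[where 'a="'a \<times> 'b"] i by simp
    then consider u where "u \<in> Basis" "(basis_list ! i :: 'a \<times> 'b) = (u, 0)"
      | v where "v \<in> Basis" "(basis_list ! i :: 'a \<times> 'b) = (0, v)"
      unfolding Basis_prod_def by auto
    then show ?thesis
    proof cases
      case 1
      obtain k where "k < DIM('a)" "basis_list ! k = u" using 1 by (elim Basis_nthE)
      then have "coords z ! i = ?e z ! k" for z
        using 1 i by (cases z) (simp add: coords_nth nth_append)
      then show ?thesis using \<open>k < DIM('a)\<close> by (intro exI[of _ k]) auto
    next
      case 2
      obtain k where "k < DIM('b)" "basis_list ! k = v" using 2 by (elim Basis_nthE)
      then have "coords z ! i = ?e z ! (DIM('a) + k)" for z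
        using 2 i by (cases z) (simp add: coords_nth nth_append)
      then show ?thesis using \<open>k < DIM('b)\<close> by (intro exI[of _ "DIM('a) + k"]) auto
    qed
  qed
  have 2: "\<exists>j<?p. \<forall>z. ?e z ! i = coords z ! j" if i: "i < ?p" for i
  proof (cases "i < DIM('a)")
    case True
    then have "(basis_list ! i :: 'a, 0) \<in> (Basis :: ('a \<times> 'b) set)"
      using basis_list_nth[OF True] by (auto simp: Basis_prod_def)
    then obtain k where k: "k < DIM('a \<times> 'b)" "basis_list ! k = (basis_list ! i :: 'a, 0 :: 'b)"
      by (rule Basis_nthE)
    then have "?e z ! i = coords z ! k" for z
      using True by (cases z) (simp add: coords_nth nth_append)
    then show ?thesis using k(1) by (intro exI[of _ k]) auto
  next
    case False
    let ?i = "i - DIM('a)"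
    have i': "?i < DIM('b)" using i False by simp
    then have "(0, basis_list ! ?i :: 'b) \<in> (Basis :: ('a \<times> 'b) set)"
      using basis_list_nth[OF i'] by (auto simp: Basis_prod_def)
    then obtain k where k: "k < DIM('a \<times> 'b)" "basis_list ! k = (0 :: 'a, basis_list ! ?i :: 'b)"
      by (rule Basis_nthE)
    then have "?e z ! i = coords z ! k" for z
      using False i' by (cases z) (simp add: coords_nth nth_append)
    then show ?thesis using k(1) by (intro exI[of _ k]) auto
  qed
  show ?thesis
  proof
    assume "definable_set S A"
    then have "coords ` A \<in> S ?p" by (simp add: definable_set_def)
    then show "?e ` A \<in> S ?p"
      by (rule change_coordinates[OF p _ _ _ _ surj 1]) auto
  next
    assume "?e ` A \<in> S ?p"
    then have "coords ` A \<in> S ?p"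
      by (rule change_coordinates[OF p _ _ _ _ surj' 2]) auto
    then show "definable_set S A" by (simp add: definable_set_def)
  qed
qed

text \<open>Predicates and maps between Euclidean spaces, rather than sets of lists, make it possible to read definability off the
  first-order form of a condition: the lemmas collected in \<open>definable_intros\<close> follow the syntax of a
  formula.\<close>

definition definable_pred :: "('a::euclidean_space \<Rightarrow> bool) \<Rightarrow> bool" where
  "definable_pred P \<longleftrightarrow> definable_set S {x. P x}"

definition definable_map :: "('a::euclidean_space \<Rightarrow> 'b::euclidean_space) \<Rightarrow> bool" where
  "definable_map f \<longleftrightarrow> definable_pred (\<lambda>z. snd z = f (fst z))"

lemma definable_pred_True: "definable_pred (\<lambda>x :: 'a::euclidean_space. True)"
proof -
  have "coords ` (UNIV :: 'a set) = {xs. length xs = DIM('a)}"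
    by (auto elim: coords_surj[where 'a='a])
  then show ?thesis
    using S_space[of "DIM('a)"] DIM_positive[where 'a='a]
    by (simp add: definable_pred_def definable_set_def)
qed

lemma definable_pred_not:
  fixes P :: "'a::euclidean_space \<Rightarrow> bool"
  assumes "definable_pred P"
  shows "definable_pred (\<lambda>x. \<not> P x)"
proof -
  have "coords ` {x. \<not> P x} = {xs. length xs = DIM('a)} - coords ` {x. P x}"
    by (auto elim!: coords_surj[where 'a='a])
  then show ?thesis
    using S_compl[of "DIM('a)"] DIM_positive[where 'a='a] assms
    by (simp add: definable_pred_def definable_set_def Suc_leI)
qed

lemma definable_pred_conj:
  fixes P Q :: "'a::euclidean_space \<Rightarrow> bool"
  assumes "definable_pred P" "definable_pred Q"
  shows "definable_pred (\<lambda>x. P x \<and> Q x)"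
proof -
  have "coords ` {x. P x \<and> Q x} = coords ` {x. P x} \<inter> coords ` {x. Q x}"
    by auto
  then show ?thesis
    using S_Int[of "DIM('a)"] DIM_positive[where 'a='a] assms
    by (simp add: definable_pred_def definable_set_def Suc_leI)
qed

lemma definable_pred_disj:
  assumes "definable_pred P" "definable_pred Q"
  shows "definable_pred (\<lambda>x. P x \<or> Q x)"
  using definable_pred_not[OF definable_pred_conj[OF definable_pred_not[OF assms(1)] definable_pred_not[OF assms(2)]]]
  by simp

lemma definable_pred_imp:
  assumes "definable_pred P" "definable_pred Q"
  shows "definable_pred (\<lambda>x. P x \<longrightarrow> Q x)"
  using definable_pred_disj[OF definable_pred_not[OF assms(1)] assms(2)]
  by simp

lemma definable_pred_finite_Ball:
  assumes "finite I" "\<And>i. i \<in> I \<Longrightarrow> definable_pred (P i)"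
  shows "definable_pred (\<lambda>x. \<forall>i\<in>I. P i x)"
  using assms
proof (induction I rule: finite_induct)
  case (insert i I)
  have "definable_pred (\<lambda>x. P i x \<and> (\<forall>i\<in>I. P i x))"
    by (intro definable_pred_conj insert.IH insert.prems) simp_all
  then show ?case by simp
qed (simp add: definable_pred_True)

lemma definable_pred_ex:
  fixes P :: "'a::euclidean_space \<Rightarrow> 'b::euclidean_space \<Rightarrow> bool"
  assumes "definable_pred (\<lambda>z. P (fst z) (snd z))"
  shows "definable_pred (\<lambda>x. \<exists>y. P x y)"
proof -
  let ?A = "{z. P (fst z) (snd z)}"
  have "take DIM('a) ` (\<lambda>(x, y). coords x @ coords y) ` ?A \<in> S DIM('a)"
    using assms DIM_positive[where 'a='a]
    by (intro projection_take[where n = "DIM('b)"])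
      (simp_all add: definable_pred_def definable_set_prod_iff Suc_leI)
  also have "take DIM('a) ` (\<lambda>(x, y). coords x @ coords y) ` ?A = coords ` {x. \<exists>y. P x y}"
    by (force simp: image_iff)
  finally show ?thesis by (simp add: definable_pred_def definable_set_def)
qed

lemma definable_pred_all:
  assumes "definable_pred (\<lambda>z. P (fst z) (snd z))"
  shows "definable_pred (\<lambda>x. \<forall>y. P x y)"
  using definable_pred_not[OF definable_pred_ex[where P = "\<lambda>x y. \<not> P x y", OF definable_pred_not[OF assms]]]
  by simp

lemma definable_pred_times:
  fixes P :: "'a::euclidean_space \<Rightarrow> bool" and Q :: "'b::euclidean_space \<Rightarrow> bool"
  assumes "definable_pred P" "definable_pred Q"
  shows "definable_pred (\<lambda>z. P (fst z) \<and> Q (snd z))"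
proof -
  have "{xs @ ys |xs ys. xs \<in> coords ` {x. P x} \<and> ys \<in> coords ` {y. Q y}} \<in> S (DIM('a) + DIM('b))"
    using assms DIM_positive[where 'a='a] DIM_positive[where 'a='b]
    by (intro cartesian_product) (simp_all add: definable_pred_def definable_set_def Suc_leI)
  also have "{xs @ ys |xs ys. xs \<in> coords ` {x. P x} \<and> ys \<in> coords ` {y. Q y}}
      = (\<lambda>(x, y). coords x @ coords y) ` {z. P (fst z) \<and> Q (snd z)}"
    by (force simp: image_iff)
  finally show ?thesis by (simp add: definable_pred_def definable_set_prod_iff)
qed

definition polynomial_on :: "('a::euclidean_space \<Rightarrow> real) \<Rightarrow> bool" where
  "polynomial_on f \<longleftrightarrow> (\<exists>q. polynomial_fun DIM('a) q \<and> (\<forall>x. f x = q (coords x)))"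

lemma polynomial_on_const: "polynomial_on (\<lambda>x :: 'a::euclidean_space. c)"
  unfolding polynomial_on_def by (rule exI[of _ "\<lambda>_. c"]) (simp add: polynomial_fun.const)

lemma polynomial_on_add:
  fixes f g :: "'a::euclidean_space \<Rightarrow> real"
  assumes "polynomial_on f" "polynomial_on g"
  shows "polynomial_on (\<lambda>x. f x + g x)"
proof -
  obtain p q where "polynomial_fun DIM('a) p" "polynomial_fun DIM('a) q"
    "\<And>x. f x = p (coords x)" "\<And>x. g x = q (coords x)"
    using assms by (auto simp: polynomial_on_def)
  then show ?thesis
    unfolding polynomial_on_def by (intro exI[of _ "\<lambda>xs. p xs + q xs"]) (simp add: polynomial_fun.add)
qed

lemma polynomial_on_mult:
  fixes f g :: "'a::euclidean_space \<Rightarrow> real"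
  assumes "polynomial_on f" "polynomial_on g"
  shows "polynomial_on (\<lambda>x. f x * g x)"
proof -
  obtain p q where "polynomial_fun DIM('a) p" "polynomial_fun DIM('a) q"
    "\<And>x. f x = p (coords x)" "\<And>x. g x = q (coords x)"
    using assms by (auto simp: polynomial_on_def)
  then show ?thesis
    unfolding polynomial_on_def by (intro exI[of _ "\<lambda>xs. p xs * q xs"]) (simp add: polynomial_fun.mult)
qed

lemma polynomial_on_sum:
  "finite I \<Longrightarrow> (\<And>i. i \<in> I \<Longrightarrow> polynomial_on (f i)) \<Longrightarrow> polynomial_on (\<lambda>x. \<Sum>i\<in>I. f i x)"
  by (induction I rule: finite_induct) (simp_all add: polynomial_on_const polynomial_on_add)

lemma polynomial_on_inner_Basis:
  assumes "(b :: 'a::euclidean_space) \<in> Basis"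
  shows "polynomial_on (\<lambda>x. x \<bullet> b)"
proof -
  obtain i where i: "i < DIM('a)" "basis_list ! i = b" using assms by (rule Basis_nthE)
  have "polynomial_fun DIM('a) (\<lambda>xs. xs ! i)" using i(1) by (rule polynomial_fun.coord)
  moreover have "x \<bullet> b = coords x ! i" for x using i by (simp add: coords_nth)
  ultimately show ?thesis unfolding polynomial_on_def by blast
qed

lemma polynomial_on_linear:
  fixes f :: "'a::euclidean_space \<Rightarrow> real"
  assumes "linear f"
  shows "polynomial_on f"
proof -
  have "f x = (\<Sum>b\<in>Basis. (x \<bullet> b) * f b)" for x
  proof -
    have "f x = f (\<Sum>b\<in>Basis. (x \<bullet> b) *\<^sub>R b)" by (simp add: euclidean_representation)
    also have "\<dots> = (\<Sum>b\<in>Basis. (x \<bullet> b) * f b)"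
      by (simp add: linear_sum[OF assms] linear_cmul[OF assms])
    finally show ?thesis .
  qed
  then have "f = (\<lambda>x. \<Sum>b\<in>Basis. (x \<bullet> b) * f b)" by blast
  moreover have "polynomial_on (\<lambda>x. \<Sum>b\<in>Basis. (x \<bullet> b) * f b)"
    by (intro polynomial_on_sum polynomial_on_mult polynomial_on_const polynomial_on_inner_Basis) simp_all
  ultimately show ?thesis by simp
qed

lemma polynomial_on_compose:
  fixes h :: "'b::euclidean_space \<Rightarrow> 'a::euclidean_space"
  assumes "polynomial_on f" "\<And>b. b \<in> Basis \<Longrightarrow> polynomial_on (\<lambda>y. h y \<bullet> b)"
  shows "polynomial_on (\<lambda>y. f (h y))"
proof -
  obtain q where q: "polynomial_fun DIM('a) q" "\<And>x. f x = q (coords x)"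
    using assms(1) by (auto simp: polynomial_on_def)
  from q(1) have "polynomial_on (\<lambda>y. q (coords (h y)))"
  proof induction
    case (coord i)
    then show ?case using assms(2)[of "basis_list ! i"] by (simp add: coords_nth basis_list_nth)
  qed (simp_all add: polynomial_on_const polynomial_on_add polynomial_on_mult)
  then show ?thesis by (simp add: q(2))
qed

lemma definable_pred_polynomial_zero:
  fixes f :: "'a::euclidean_space \<Rightarrow> real"
  assumes "polynomial_on f"
  shows "definable_pred (\<lambda>x. f x = 0)"
proof -
  obtain q where q: "polynomial_fun DIM('a) q" "\<And>x. f x = q (coords x)"
    using assms by (auto simp: polynomial_on_def)
  have "coords ` {x. f x = 0} = {xs. length xs = DIM('a) \<and> (\<forall>h\<in>{q}. h xs = 0)}"
    by (auto simp: q(2) elim: coords_surj[where 'a='a])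
  moreover have "real_algebraic_set DIM('a) {xs. length xs = DIM('a) \<and> (\<forall>h\<in>{q}. h xs = 0)}"
    unfolding real_algebraic_set_def using q(1) by (intro exI[of _ "{q}"]) simp
  ultimately show ?thesis
    using algebraic[of "DIM('a)"] DIM_positive[where 'a='a]
    by (simp add: definable_pred_def definable_set_def Suc_leI)
qed

lemma definable_map_polynomial:
  fixes f :: "'a::euclidean_space \<Rightarrow> 'b::euclidean_space"
  assumes "\<And>b. b \<in> Basis \<Longrightarrow> polynomial_on (\<lambda>x. f x \<bullet> b)"
  shows "definable_map f"
proof -
  have "polynomial_on (\<lambda>z :: 'a \<times> 'b. snd z \<bullet> b)" if "b \<in> Basis" for b
    by (intro polynomial_on_linear bounded_linear.linear bounded_linear_intros)
  moreover have "polynomial_on (\<lambda>z :: 'a \<times> 'b. f (fst z) \<bullet> b)" if "b \<in> Basis" for b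
    by (rule polynomial_on_compose[where h = fst and f = "\<lambda>x. f x \<bullet> b", OF assms[OF that]])
      (intro polynomial_on_linear bounded_linear.linear bounded_linear_intros)
  ultimately have "definable_pred (\<lambda>z :: 'a \<times> 'b. \<forall>b\<in>Basis. snd z \<bullet> b + (- 1) * (f (fst z) \<bullet> b) = 0)"
    by (intro definable_pred_finite_Ball definable_pred_polynomial_zero polynomial_on_add
        polynomial_on_mult polynomial_on_const) simp_all
  then show ?thesis
    by (simp add: definable_map_def euclidean_eq_iff[where 'a='b])
qed

lemma definable_map_linear: "linear f \<Longrightarrow> definable_map f"
  by (intro definable_map_polynomial polynomial_on_linear)
    (use linear_compose[of f, OF _ bounded_linear.linear[OF bounded_linear_inner_left]] in \<open>simp add: o_def\<close>)

text \<open>Substituting \<open>f x\<close> for a variable is the quantification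
  \<open>\<exists>y. y = f x \<and> P y\<close>.\<close>

lemma definable_pred_vimage:
  fixes f :: "'a::euclidean_space \<Rightarrow> 'b::euclidean_space"
  assumes "definable_map f" "definable_pred P"
  shows "definable_pred (\<lambda>x. P (f x))"
proof -
  have "definable_pred (\<lambda>z :: 'a \<times> 'b. P (snd z))"
    using definable_pred_times[OF definable_pred_True assms(2), where 'a='a] by simp
  then have "definable_pred (\<lambda>z. snd z = f (fst z) \<and> P (snd z))"
    using assms(1) by (simp add: definable_map_def definable_pred_conj)
  then have "definable_pred (\<lambda>x. \<exists>y. y = f x \<and> P y)"
    by (rule definable_pred_ex)
  then show ?thesis by simp
qed

lemma definable_pred_linear_vimage: "bounded_linear f \<Longrightarrow> definable_pred P \<Longrightarrow> definable_pred (\<lambda>x. P (f x))"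
  by (rule definable_pred_vimage[OF definable_map_linear[OF bounded_linear.linear]])

lemma definable_map_compose:
  fixes f :: "'a::euclidean_space \<Rightarrow> 'b::euclidean_space" and g :: "'b \<Rightarrow> 'c::euclidean_space"
  assumes "definable_map g" "definable_map f"
  shows "definable_map (\<lambda>x. g (f x))"
proof -
  have "definable_pred (\<lambda>u :: ('a \<times> 'c) \<times> 'b. snd (fst (fst u), snd u) = f (fst (fst (fst u), snd u)))"
    using assms(2) unfolding definable_map_def
    by (rule definable_pred_linear_vimage[rotated, where f = "\<lambda>u. (fst (fst u), snd u)"])
      (intro bounded_linear_intros)
  moreover have "definable_pred (\<lambda>u :: ('a \<times> 'c) \<times> 'b. snd (snd u, snd (fst u)) = g (fst (snd u, snd (fst u))))"
    using assms(1) unfolding definable_map_def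
    by (rule definable_pred_linear_vimage[rotated, where f = "\<lambda>u. (snd u, snd (fst u))"])
      (intro bounded_linear_intros)
  ultimately have "definable_pred (\<lambda>u :: ('a \<times> 'c) \<times> 'b. snd u = f (fst (fst u)) \<and> snd (fst u) = g (snd u))"
    unfolding fst_conv snd_conv by (rule definable_pred_conj)
  then have "definable_pred (\<lambda>z :: 'a \<times> 'c. \<exists>y. y = f (fst z) \<and> snd z = g y)"
    by (rule definable_pred_ex)
  then show ?thesis by (simp add: definable_map_def)
qed

lemma definable_map_Pair:
  fixes f :: "'a::euclidean_space \<Rightarrow> 'b::euclidean_space" and g :: "'a \<Rightarrow> 'c::euclidean_space"
  assumes "definable_map f" "definable_map g"
  shows "definable_map (\<lambda>x. (f x, g x))"
proof -
  have "definable_pred (\<lambda>u :: 'a \<times> 'b \<times> 'c. snd (fst u, fst (snd u)) = f (fst (fst u, fst (snd u))))"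
    using assms(1) unfolding definable_map_def
    by (rule definable_pred_linear_vimage[rotated, where f = "\<lambda>u. (fst u, fst (snd u))"])
      (intro bounded_linear_intros)
  moreover have "definable_pred (\<lambda>u :: 'a \<times> 'b \<times> 'c. snd (fst u, snd (snd u)) = g (fst (fst u, snd (snd u))))"
    using assms(2) unfolding definable_map_def
    by (rule definable_pred_linear_vimage[rotated, where f = "\<lambda>u. (fst u, snd (snd u))"])
      (intro bounded_linear_intros)
  ultimately show ?thesis
    unfolding fst_conv snd_conv definable_map_def prod_eq_iff by (rule definable_pred_conj)
qed

lemma definable_map_id: "definable_map (\<lambda>x. x)"
  by (intro definable_map_linear bounded_linear.linear bounded_linear_intros)

lemma definable_map_const: "definable_map (\<lambda>x. c)"
  by (intro definable_map_polynomial polynomial_on_const)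

lemma definable_map_fst: "definable_map f \<Longrightarrow> definable_map (\<lambda>x. fst (f x))"
  by (rule definable_map_compose[where g = fst])
    (intro definable_map_linear bounded_linear.linear bounded_linear_intros)

lemma definable_map_snd: "definable_map f \<Longrightarrow> definable_map (\<lambda>x. snd (f x))"
  by (rule definable_map_compose[where g = snd])
    (intro definable_map_linear bounded_linear.linear bounded_linear_intros)

lemma definable_map_binary:
  assumes "definable_map (\<lambda>z. h (fst z) (snd z))" "definable_map f" "definable_map g"
  shows "definable_map (\<lambda>x. h (f x) (g x))"
  using definable_map_compose[OF assms(1) definable_map_Pair[OF assms(2,3)]] by simp

lemma definable_map_add: "definable_map f \<Longrightarrow> definable_map g \<Longrightarrow> definable_map (\<lambda>x. f x + g x)"
  by (rule definable_map_binary[where h = "(+)"])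
    (intro definable_map_linear bounded_linear.linear bounded_linear_intros)

lemma definable_map_diff: "definable_map f \<Longrightarrow> definable_map g \<Longrightarrow> definable_map (\<lambda>x. f x - g x)"
  by (rule definable_map_binary[where h = "(-)"])
    (intro definable_map_linear bounded_linear.linear bounded_linear_intros)

lemma definable_map_scaleR:
  fixes g :: "'a::euclidean_space \<Rightarrow> 'b::euclidean_space"
  assumes "definable_map f" "definable_map g"
  shows "definable_map (\<lambda>x. f x *\<^sub>R g x)"
proof (rule definable_map_binary[where h = scaleR, OF _ assms], rule definable_map_polynomial)
  fix b :: 'b assume "b \<in> Basis"
  have "polynomial_on (\<lambda>z :: real \<times> 'b. fst z * (snd z \<bullet> b))"
    by (intro polynomial_on_mult polynomial_on_linear bounded_linear.linear bounded_linear_intros)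
  then show "polynomial_on (\<lambda>z :: real \<times> 'b. (fst z *\<^sub>R snd z) \<bullet> b)" by simp
qed

lemma definable_map_mult:
  fixes f g :: "'a::euclidean_space \<Rightarrow> real"
  shows "definable_map f \<Longrightarrow> definable_map g \<Longrightarrow> definable_map (\<lambda>x. f x * g x)"
  using definable_map_scaleR[of f g] by simp

lemma definable_map_inner:
  fixes f g :: "'a::euclidean_space \<Rightarrow> 'b::euclidean_space"
  assumes "definable_map f" "definable_map g"
  shows "definable_map (\<lambda>x. f x \<bullet> g x)"
proof (rule definable_map_binary[where h = inner, OF _ assms], rule definable_map_polynomial)
  fix b :: real assume "b \<in> Basis"
  have "polynomial_on (\<lambda>z :: 'b \<times> 'b. \<Sum>i\<in>Basis. (fst z \<bullet> i) * (snd z \<bullet> i))"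
    by (intro polynomial_on_sum polynomial_on_mult polynomial_on_linear bounded_linear.linear
        bounded_linear_intros) simp
  then show "polynomial_on (\<lambda>z :: 'b \<times> 'b. (fst z \<bullet> snd z) \<bullet> b)"
    using \<open>b \<in> Basis\<close> by (simp add: euclidean_inner[symmetric])
qed

text \<open>The order is definable from the field structure: nonnegative numbers are squares.\<close>

lemma definable_pred_le:
  fixes f g :: "'a::euclidean_space \<Rightarrow> real"
  assumes "definable_map f" "definable_map g"
  shows "definable_pred (\<lambda>x. f x \<le> g x)"
proof -
  have "polynomial_on (\<lambda>z :: real \<times> real. fst z + (- 1) * (snd z * snd z))"
    by (intro polynomial_on_add polynomial_on_mult polynomial_on_const polynomial_on_linear
        bounded_linear.linear bounded_linear_intros)
  then have "definable_pred (\<lambda>z :: real \<times> real. fst z + (- 1) * (snd z * snd z) = 0)"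
    by (rule definable_pred_polynomial_zero)
  then have "definable_pred (\<lambda>t :: real. \<exists>s :: real. t + (- 1) * (s * s) = 0)"
    by (rule definable_pred_ex)
  also have "(\<lambda>t :: real. \<exists>s :: real. t + (- 1) * (s * s) = 0) = (\<lambda>t. 0 \<le> t)"
  proof (rule ext)
    fix t :: real
    show "(\<exists>s. t + (- 1) * (s * s) = 0) \<longleftrightarrow> 0 \<le> t"
      by (auto intro!: exI[of _ "sqrt t"])
  qed
  finally show ?thesis
    using definable_pred_vimage[OF definable_map_diff[OF assms(2,1)]] by fastforce
qed

lemma definable_pred_less:
  fixes f g :: "'a::euclidean_space \<Rightarrow> real"
  assumes "definable_map f" "definable_map g"
  shows "definable_pred (\<lambda>x. f x < g x)"
  using definable_pred_not[OF definable_pred_le[OF assms(2,1)]] by (simp add: not_le)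

lemma definable_pred_eq:
  fixes f g :: "'a::euclidean_space \<Rightarrow> 'b::euclidean_space"
  assumes "definable_map f" "definable_map g"
  shows "definable_pred (\<lambda>x. f x = g x)"
proof -
  have "definable_pred (\<lambda>x. \<forall>b\<in>Basis. f x \<bullet> b \<le> g x \<bullet> b \<and> g x \<bullet> b \<le> f x \<bullet> b)"
    by (intro definable_pred_finite_Ball definable_pred_conj definable_pred_le definable_map_inner
        definable_map_const assms) simp
  also have "(\<lambda>x. \<forall>b\<in>Basis. f x \<bullet> b \<le> g x \<bullet> b \<and> g x \<bullet> b \<le> f x \<bullet> b) = (\<lambda>x. f x = g x)"
    by (auto simp: fun_eq_iff euclidean_eq_iff[where 'a='b])
  finally show ?thesis .
qed

lemmas definable_intros =
  definable_pred_True definable_pred_not definable_pred_conj definable_pred_disj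
  definable_pred_imp definable_pred_ex definable_pred_all
  definable_pred_le definable_pred_less definable_pred_eq
  definable_map_id definable_map_const definable_map_fst definable_map_snd definable_map_Pair
  definable_map_add definable_map_diff definable_map_scaleR definable_map_mult definable_map_inner

lemma definable_map_norm:
  fixes f :: "'a::euclidean_space \<Rightarrow> 'b::euclidean_space"
  assumes "definable_map f"
  shows "definable_map (\<lambda>x. norm (f x))"
proof (rule definable_map_compose[OF _ assms])
  have "definable_pred (\<lambda>z :: 'b \<times> real. 0 \<le> snd z \<and> fst z \<bullet> fst z = snd z * snd z)"
    by (intro definable_intros)
  also have "(\<lambda>z :: 'b \<times> real. 0 \<le> snd z \<and> fst z \<bullet> fst z = snd z * snd z) = (\<lambda>z. snd z = norm (fst z))"
    by (intro ext) (metis norm_ge_zero norm_eq_square power2_eq_square)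
  finally show "definable_map (norm :: 'b \<Rightarrow> real)" by (simp add: definable_map_def)
qed

lemma definable_map_definable_fun:
  assumes "definable_fun S f"
  shows "definable_map f"
proof -
  have "(\<lambda>(x, y). coords x @ coords y) ` {z. snd z = f (fst z)} = range (\<lambda>x. coords x @ coords (f x))"
    by (force simp: image_iff)
  then show ?thesis
    using assms by (simp add: definable_map_def definable_pred_def definable_set_prod_iff definable_fun_def)
qed

section \<open>Germs of definable sets and functions of one variable\<close>

lemma coords_real: "coords (t :: real) = [t]"
proof -
  have "length (basis_list :: real list) = 1" using length_basis_list[where 'a=real] by simp
  then obtain b where b: "(basis_list :: real list) = [b]" by (auto simp: length_Suc_conv)
  have "b = 1" using basis_list(2)[where 'a=real] unfolding b by simp
  then show ?thesis unfolding coords_def b by simp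
qed

text \<open>The sets with this dichotomy at \<open>a\<close> contain the intervals and points and are closed under finite unions,
  so dimension one of the structure supplies no others.\<close>

lemma definable_pred_germ:
  fixes P :: "real \<Rightarrow> bool"
  assumes "definable_pred P"
  shows "eventually P (at_right a) \<or> eventually (\<lambda>t. \<not> P t) (at_right a)"
proof -
  define G where "G A \<longleftrightarrow> eventually (\<lambda>t. t \<in> A) (at_right a) \<or> eventually (\<lambda>t. t \<notin> A) (at_right a)"
    for A :: "real set"
  have G_Un: "G (A \<union> B)" if AB: "G A" "G B" for A B
  proof -
    consider "eventually (\<lambda>t. t \<in> A) (at_right a)" | "eventually (\<lambda>t. t \<in> B) (at_right a)"
      | "eventually (\<lambda>t. t \<notin> A) (at_right a)" "eventually (\<lambda>t. t \<notin> B) (at_right a)"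
      using AB unfolding G_def by blast
    then show ?thesis
    proof cases
      case 1
      then have "eventually (\<lambda>t. t \<in> A \<union> B) (at_right a)" by (rule eventually_mono) simp
      then show ?thesis by (simp add: G_def)
    next
      case 2
      then have "eventually (\<lambda>t. t \<in> A \<union> B) (at_right a)" by (rule eventually_mono) simp
      then show ?thesis by (simp add: G_def)
    next
      case 3
      from eventually_conj[OF this] show ?thesis by (simp add: G_def)
    qed
  qed
  have G_Union: "G (\<Union>\<A>)" if "finite \<A>" "\<And>A. A \<in> \<A> \<Longrightarrow> G A" for \<A>
    using that by (induction \<A>) (simp_all add: G_Un, simp add: G_def)
  have G_interval: "G I" if I: "is_interval I" for I
  proof (cases "eventually (\<lambda>t. t \<notin> I) (at_right a)")
    case False
    then have near: "\<exists>u\<in>I. a < u \<and> u < b" if "b > a" for b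
      using that by (auto simp: eventually_at_right_field)
    obtain q where q: "q \<in> I" "a < q" using near[of "a + 1"] by auto
    have "t \<in> I" if t: "a < t" "t < q" for t
    proof -
      obtain u where "u \<in> I" "a < u" "u < t" using near[of t] t by auto
      with q(1) t show "t \<in> I"
        using I[unfolded is_interval_1, rule_format, of u q t] by simp
    qed
    then have "eventually (\<lambda>t. t \<in> I) (at_right a)"
      using q(2) by (auto simp: eventually_at_right_field)
    then show ?thesis by (simp add: G_def)
  qed (simp add: G_def)
  have "(\<lambda>t. [t]) ` {t. P t} \<in> S 1"
    using assms by (simp add: definable_pred_def definable_set_def coords_real)
  then obtain Q \<I> where fin: "finite Q" "finite \<I>" and int: "\<forall>I\<in>\<I>. open I \<and> is_interval I"
    and eq: "(\<lambda>t. [t]) ` {t. P t} = (\<lambda>t. [t]) ` (Q \<union> \<Union>\<I>)"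
    unfolding dimension_one mem_Collect_eq by (elim exE conjE) (rule that)
  have "{t. P t} = Q \<union> \<Union>\<I>"
    using eq inj_image_eq_iff[of "\<lambda>t :: real. [t]"] by (simp add: inj_def)
  moreover have "G (\<Union>((\<lambda>p. {p}) ` Q))" by (rule G_Union) (use fin in \<open>auto intro: G_interval simp: is_interval_1\<close>)
  moreover have "G (\<Union>\<I>)" by (rule G_Union) (use fin int G_interval in auto)
  ultimately have "G {t. P t}" using G_Un by simp
  then show ?thesis unfolding G_def by simp
qed

lemma definable_pred_germ_left:
  fixes P :: "real \<Rightarrow> bool"
  assumes "definable_pred P"
  shows "eventually P (at_left a) \<or> eventually (\<lambda>t. \<not> P t) (at_left a)"
proof -
  have "definable_pred (\<lambda>t. P (0 - t))"
    by (rule definable_pred_vimage[OF _ assms]) (intro definable_intros)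
  from definable_pred_germ[OF this, of "- a"] show ?thesis
    by (simp add: at_left_minus[of a] eventually_filtermap)
qed

end

text \<open>A strict local minimum is the unique minimum of \<open>f\<close> on some interval with rational endpoints, and is
  therefore determined by that interval.\<close>

lemma countable_strict_local_minima:
  fixes f :: "real \<Rightarrow> real"
  shows "countable {x. \<exists>d>0. \<forall>t. t \<noteq> x \<and> \<bar>t - x\<bar> < d \<longrightarrow> f x < f t}" 
proof -
  define M where "M = {x. \<exists>d>0. \<forall>t. t \<noteq> x \<and> \<bar>t - x\<bar> < d \<longrightarrow> f x < f t}"
  have "\<exists>p q :: rat. of_rat p < x \<and> x < of_rat q \<and> (\<forall>t. t \<noteq> x \<and> of_rat p < t \<and> t < of_rat q \<longrightarrow> f x < f t)"
    if x: "x \<in> M" for x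
  proof -
    from x[unfolded M_def] obtain d where d: "d > 0" "\<And>t. t \<noteq> x \<and> \<bar>t - x\<bar> < d \<longrightarrow> f x < f t" by blast
    obtain p where p: "x - d < of_rat p" "of_rat p < x"
      using of_rat_dense[of "x - d" x] d(1) by auto
    obtain q where q: "x < of_rat q" "of_rat q < x + d"
      using of_rat_dense[of x "x + d"] d(1) by auto
    have "f x < f t" if "t \<noteq> x \<and> of_rat p < t \<and> t < of_rat q" for t
      by (rule d(2)[rule_format]) (use that p q in auto)
    then show ?thesis using p(2) q(1) by blast
  qed
  then have "\<forall>x\<in>M. \<exists>w :: rat \<times> rat. of_rat (fst w) < x \<and> x < of_rat (snd w) \<and>
      (\<forall>t. t \<noteq> x \<and> of_rat (fst w) < t \<and> t < of_rat (snd w) \<longrightarrow> f x < f t)"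
    unfolding split_paired_Ex fst_conv snd_conv by (rule ballI)
  from bchoice[OF this] obtain w :: "real \<Rightarrow> rat \<times> rat" where
    w': "\<forall>x\<in>M. of_rat (fst (w x)) < x \<and> x < of_rat (snd (w x)) \<and>
      (\<forall>t. t \<noteq> x \<and> of_rat (fst (w x)) < t \<and> t < of_rat (snd (w x)) \<longrightarrow> f x < f t)"
    by (elim exE) (rule that)
  have w: "of_rat (fst (w x)) < x" "x < of_rat (snd (w x))"
    "t \<noteq> x \<Longrightarrow> of_rat (fst (w x)) < t \<Longrightarrow> t < of_rat (snd (w x)) \<Longrightarrow> f x < f t"
    if "x \<in> M" for x t
    using w'[rule_format, OF that] by auto
  have "inj_on w M"
  proof (rule inj_onI, rule ccontr)
    fix x y assume xy: "x \<in> M" "y \<in> M" "w x = w y" "x \<noteq> y"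
    have "f x < f y" by (rule w(3)[OF xy(1)]) (use xy(3,4) w(1,2)[OF xy(2)] in auto)
    moreover have "f y < f x" by (rule w(3)[OF xy(2)]) (use xy(3,4) w(1,2)[OF xy(1)] in auto)
    ultimately show False by simp
  qed
  then show ?thesis unfolding M_def[symmetric] by (rule countable_image_inj_on[rotated]) (rule countableI_type)
qed

lemma not_eventually_strict_local_minimum:
  fixes f :: "real \<Rightarrow> real"
  assumes R: "\<forall>\<^sub>F x in at_right a. \<forall>\<^sub>F t in at_right x. f x < f t"
    and L: "\<forall>\<^sub>F x in at_right a. \<forall>\<^sub>F t in at_left x. f x < f t"
  shows False
proof -
  obtain b where b: "a < b" "\<And>x. a < x \<Longrightarrow> x < b \<Longrightarrow> (\<forall>\<^sub>F t in at_right x. f x < f t) \<and> (\<forall>\<^sub>F t in at_left x. f x < f t)"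
    using eventually_conj[OF R L] unfolding eventually_at_right_field[of _ a] by blast
  have "{a<..<b} \<subseteq> {x. \<exists>d>0. \<forall>t. t \<noteq> x \<and> \<bar>t - x\<bar> < d \<longrightarrow> f x < f t}"
  proof
    fix x assume "x \<in> {a<..<b}"
    then have "\<forall>\<^sub>F t in at x. f x < f t"
      using b(2)[of x] by (simp add: eventually_at_split)
    then obtain d where "d > 0" "\<And>t. t \<noteq> x \<Longrightarrow> \<bar>t - x\<bar> < d \<Longrightarrow> f x < f t"
      by (auto simp: eventually_at dist_real_def)
    then show "x \<in> {x. \<exists>d>0. \<forall>t. t \<noteq> x \<and> \<bar>t - x\<bar> < d \<longrightarrow> f x < f t}"
      by (intro CollectI exI[of _ d]) simp
  qed
  then have "countable {a<..<b}" by (rule countable_subset) (rule countable_strict_local_minima)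
  then show False using uncountable_open_interval[of a b] \<open>a < b\<close> by simp
qed

text \<open>The supremum of the points of \<open>[s, t]\<close> where \<open>f\<close> is at least \<open>f s\<close> belongs to
  this set and cannot lie before \<open>t\<close>.\<close>

lemma mono_if_locally_mono:
  fixes f :: "real \<Rightarrow> real"
  assumes R: "\<And>x. a < x \<Longrightarrow> x < b \<Longrightarrow> \<forall>\<^sub>F t in at_right x. f x \<le> f t"
    and L: "\<And>x. a < x \<Longrightarrow> x < b \<Longrightarrow> \<forall>\<^sub>F t in at_left x. f t \<le> f x"
  shows "mono_on {a<..<b} f"
proof (rule mono_onI)
  fix s t assume "s \<in> {a<..<b}" "t \<in> {a<..<b}" "s \<le> t"
  then have st: "a < s" "s \<le> t" "t < b" by auto
  define U where "U = {u. s \<le> u \<and> u \<le> t \<and> f s \<le> f u}"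
  define c where "c = Sup U"
  have s: "s \<in> U" using st by (simp add: U_def)
  have bdd: "bdd_above U" by (auto simp: U_def bdd_above_def)
  have sc: "s \<le> c" unfolding c_def by (rule cSup_upper[OF s bdd])
  have ct: "c \<le> t" unfolding c_def by (rule cSup_least) (use s in \<open>auto simp: U_def\<close>)
  have c: "a < c" "c < b" using sc ct st by simp_all
  have "f s \<le> f c"
  proof -
    obtain d where d: "d < c" "\<And>t. d < t \<Longrightarrow> t < c \<Longrightarrow> f t \<le> f c"
      using L[OF c] by (auto simp: eventually_at_left_field)
    have "d < Sup U" using d(1) by (simp add: c_def)
    then obtain u where u: "u \<in> U" "d < u" using less_cSup_iff[of U d] s bdd by blast
    have "u \<le> c" unfolding c_def by (rule cSup_upper[OF u(1) bdd])
    then have "f u \<le> f c" using d(2)[of u] u(2) by (cases "u = c") auto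
    then show ?thesis using u(1) by (simp add: U_def)
  qed
  moreover have "c = t"
  proof (rule ccontr)
    assume "c \<noteq> t"
    then have "c < t" using ct by simp
    obtain d where d: "d > c" "\<And>t. c < t \<Longrightarrow> t < d \<Longrightarrow> f c \<le> f t"
      using R[OF c] by (auto simp: eventually_at_right_field)
    obtain v where v: "c < v" "v < min d t" using dense[of c "min d t"] d(1) \<open>c < t\<close> by auto
    then have "v \<in> U" using d(2)[of v] \<open>f s \<le> f c\<close> sc by (simp add: U_def)
    then have "v \<le> c" unfolding c_def by (rule cSup_upper[OF _ bdd])
    then show False using v(1) by simp
  qed
  ultimately show "f s \<le> f t" by simp
qed

context o_minimal_structure
begin

lemma definable_rel:
  assumes "definable_pred (\<lambda>z. A (fst z) (snd z))" "definable_map f" "definable_map g"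
  shows "definable_pred (\<lambda>x. A (f x) (g x))"
  using definable_pred_vimage[OF definable_map_Pair[OF assms(2,3)] assms(1)] by simp

text \<open>Whether \<open>f x < f t\<close> holds for \<open>t\<close> slightly to the right of \<open>x\<close> is definable
  in \<open>x\<close>, hence of constant answer near \<open>a\<close>; where the answer is negative, the germ dichotomy
  in \<open>t\<close> gives the converse inequality.\<close>

lemma definable_local_comparison_right:
  fixes f :: "real \<Rightarrow> real"
  assumes f: "definable_map f"
  shows "(\<forall>\<^sub>F x in at_right a. \<forall>\<^sub>F t in at_right x. f x < f t) \<or>
    (\<forall>\<^sub>F x in at_right a. \<forall>\<^sub>F t in at_right x. f t \<le> f x)"
proof -
  note intros = definable_intros definable_map_compose[OF f]
  have "definable_pred (\<lambda>x. \<exists>b. x < b \<and> (\<forall>t. x < t \<longrightarrow> t < b \<longrightarrow> f x < f t))" by (intro intros)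
  then have "definable_pred (\<lambda>x. \<forall>\<^sub>F t in at_right x. f x < f t)"
    by (simp add: eventually_at_right_field)
  from definable_pred_germ[OF this, of a] show ?thesis
  proof
    assume "\<forall>\<^sub>F x in at_right a. \<not> (\<forall>\<^sub>F t in at_right x. f x < f t)"
    then have "\<forall>\<^sub>F x in at_right a. \<forall>\<^sub>F t in at_right x. f t \<le> f x"
    proof (rule eventually_mono)
      fix x assume "\<not> (\<forall>\<^sub>F t in at_right x. f x < f t)"
      moreover have "definable_pred (\<lambda>t. f x < f t)" by (intro intros)
      ultimately show "\<forall>\<^sub>F t in at_right x. f t \<le> f x"
        using definable_pred_germ[of "\<lambda>t. f x < f t" x] by (simp add: not_less)
    qed
    then show ?thesis ..
  qed simp
qed

lemma definable_local_comparison_left: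
  fixes f :: "real \<Rightarrow> real"
  assumes f: "definable_map f"
  shows "(\<forall>\<^sub>F x in at_right a. \<forall>\<^sub>F t in at_left x. f x < f t) \<or>
    (\<forall>\<^sub>F x in at_right a. \<forall>\<^sub>F t in at_left x. f t \<le> f x)"
proof -
  note intros = definable_intros definable_map_compose[OF f]
  have "definable_pred (\<lambda>x. \<exists>b. b < x \<and> (\<forall>t. b < t \<longrightarrow> t < x \<longrightarrow> f x < f t))" by (intro intros)
  then have "definable_pred (\<lambda>x. \<forall>\<^sub>F t in at_left x. f x < f t)"
    by (simp add: eventually_at_left_field)
  from definable_pred_germ[OF this, of a] show ?thesis
  proof
    assume "\<forall>\<^sub>F x in at_right a. \<not> (\<forall>\<^sub>F t in at_left x. f x < f t)"
    then have "\<forall>\<^sub>F x in at_right a. \<forall>\<^sub>F t in at_left x. f t \<le> f x"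
    proof (rule eventually_mono)
      fix x assume "\<not> (\<forall>\<^sub>F t in at_left x. f x < f t)"
      moreover have "definable_pred (\<lambda>t. f x < f t)" by (intro intros)
      ultimately show "\<forall>\<^sub>F t in at_left x. f t \<le> f x"
        using definable_pred_germ_left[of "\<lambda>t. f x < f t" x] by (simp add: not_less)
    qed
    then show ?thesis ..
  qed simp
qed

text \<open>Near \<open>a\<close>, the comparisons of \<open>f x\<close> with the values shortly before and shortly after
  \<open>x\<close> do not depend on \<open>x\<close>. All combinations make \<open>f\<close> or \<open>- f\<close>
  locally monotone, except that all points could be strict local minima of \<open>f\<close>, or of \<open>- f\<close>;
  an interval is too large for that.\<close>

lemma definable_mono_germ:
  fixes f :: "real \<Rightarrow> real"
  assumes f: "definable_map f"
  shows "\<exists>b>a. mono_on {a<..<b} f \<or> mono_on {a<..<b} (\<lambda>t. - f t)"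
proof -
  have f': "definable_map (\<lambda>t. - f t)"
    using definable_map_diff[OF definable_map_const f, of 0] by simp
  have up: "\<exists>b>a. mono_on {a<..<b} g"
    if mono: "\<forall>\<^sub>F x in at_right a. \<forall>\<^sub>F t in at_right x. g x \<le> g t"
      "\<forall>\<^sub>F x in at_right a. \<forall>\<^sub>F t in at_left x. g t \<le> g x" for g :: "real \<Rightarrow> real"
  proof -
    obtain b where "a < b" "\<And>x. a < x \<Longrightarrow> x < b \<Longrightarrow> (\<forall>\<^sub>F t in at_right x. g x \<le> g t) \<and> (\<forall>\<^sub>F t in at_left x. g t \<le> g x)"
      using eventually_conj[OF mono] unfolding eventually_at_right_field[of _ a] by blast
    then show ?thesis using mono_if_locally_mono[of a b g] by blast
  qed
  have weaken: "\<forall>\<^sub>F x in at_right a. \<forall>\<^sub>F t in H x. Q x t"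
    if "\<forall>\<^sub>F x in at_right a. \<forall>\<^sub>F t in H x. P x t" "\<And>x t. P x t \<Longrightarrow> Q x t"
    for H :: "real \<Rightarrow> real filter" and P Q
    using that(1) by (rule eventually_mono) (erule eventually_mono, rule that(2))
  show ?thesis
    using definable_local_comparison_right[OF f, of a]
  proof
    assume r: "\<forall>\<^sub>F x in at_right a. \<forall>\<^sub>F t in at_right x. f x < f t"
    show ?thesis using definable_local_comparison_left[OF f, of a]
    proof
      assume "\<forall>\<^sub>F x in at_right a. \<forall>\<^sub>F t in at_left x. f x < f t"
      with r have False by (rule not_eventually_strict_local_minimum)
      then show ?thesis ..
    next
      assume l: "\<forall>\<^sub>F x in at_right a. \<forall>\<^sub>F t in at_left x. f t \<le> f x"
      have "\<exists>b>a. mono_on {a<..<b} f" by (rule up[OF weaken[OF r] l]) simp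
      then show ?thesis by blast
    qed
  next
    assume r: "\<forall>\<^sub>F x in at_right a. \<forall>\<^sub>F t in at_right x. f t \<le> f x"
    show ?thesis using definable_local_comparison_left[OF f', of a]
    proof
      assume l: "\<forall>\<^sub>F x in at_right a. \<forall>\<^sub>F t in at_left x. - f x < - f t"
      show ?thesis using definable_local_comparison_right[OF f', of a]
      proof
        assume "\<forall>\<^sub>F x in at_right a. \<forall>\<^sub>F t in at_right x. - f x < - f t"
        from not_eventually_strict_local_minimum[OF this l] show ?thesis ..
      next
        assume r': "\<forall>\<^sub>F x in at_right a. \<forall>\<^sub>F t in at_right x. - f t \<le> - f x"
        have "\<exists>b>a. mono_on {a<..<b} f" by (rule up[OF weaken[OF r'] weaken[OF l]]) simp_all
        then show ?thesis by blast
      qed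
    next
      assume l: "\<forall>\<^sub>F x in at_right a. \<forall>\<^sub>F t in at_left x. - f t \<le> - f x"
      have "\<exists>b>a. mono_on {a<..<b} (\<lambda>t. - f t)" by (rule up[OF weaken[OF r] l]) simp
      then show ?thesis by blast
    qed
  qed
qed

end

section \<open>Selection and desingularization\<close>

text \<open>On a subdivision into equal pieces of length \<open>h\<close>, the quadratic term is harmless on the pieces where
  \<open>s\<close> increases by less than \<open>e\<close>. On the other pieces
  \<open>h \<le> (h / e) \<delta>\<close> with \<open>\<delta>\<close> the increase of \<open>s\<close>, and
  \<open>h / e\<close> tends to 0 with the mesh. So jumps of \<open>s\<close> do no harm.\<close>

lemma increment_bound_by_subdivision:
  fixes s :: "real \<Rightarrow> real"
  assumes rt: "r \<le> t" and K: "K \<ge> 0" and C: "C \<ge> 0"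
    and mono: "\<And>u v. r \<le> u \<Longrightarrow> u \<le> v \<Longrightarrow> v \<le> t \<Longrightarrow> s u \<le> s v"
    and inc: "\<And>u v. r \<le> u \<Longrightarrow> u \<le> v \<Longrightarrow> v \<le> t \<Longrightarrow> v - u \<le> K * (s v - s u) + C * (s v - s u)\<^sup>2"
  shows "t - r \<le> K * (s t - s r)"
proof -
  define T where "T = s t - s r"
  have T: "T \<ge> 0" using mono[of r t] rt by (simp add: T_def)
  have main: "t - r \<le> (K + C * e + e) * T" if e: "e > 0" for e
  proof -
    \<comment> \<open>This many pieces make the mesh at most \<open>e\<^sup>2\<close>, so that \<open>h / e\<close> is at most
      \<open>e\<close>.\<close>
    obtain N :: nat where N': "(t - r) / (e * e) < real N" using reals_Archimedean2 by blast
    moreover have "0 \<le> (t - r) / (e * e)" using rt e by simp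
    ultimately have N: "N > 0" by linarith
    define h where "h = (t - r) / real N"
    have h: "h \<ge> 0" "h \<le> e * e"
      using rt N N' e by (simp_all add: h_def field_simps)
    have Nh: "real N * h = t - r" using N by (simp add: h_def)
    define u where "u i = r + real i * h" for i
    have uN: "u N = t" "u 0 = r" using N by (simp_all add: u_def h_def)
    have step: "h \<le> (K + C * e + e) * (s (u (Suc i)) - s (u i))" if "i < N" for i
    proof -
      have "real (Suc i) * h \<le> real N * h" using that h(1) by (intro mult_right_mono) auto
      then have in_range: "r \<le> u i" "u i \<le> u (Suc i)" "u (Suc i) \<le> t"
        using h(1) Nh mult_nonneg_nonneg[OF of_nat_0_le_iff[of i] h(1)] by (simp_all add: u_def algebra_simps)
      define \<delta> where "\<delta> = s (u (Suc i)) - s (u i)"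
      have \<delta>: "\<delta> \<ge> 0" using mono[OF in_range] by (simp add: \<delta>_def)
      have "h \<le> (K + C * e + e) * \<delta>"
      proof (cases "\<delta> < e")
        case True
        have "h \<le> K * \<delta> + C * \<delta>\<^sup>2"
          using inc[OF in_range] by (simp add: u_def \<delta>_def algebra_simps)
        also have "\<delta>\<^sup>2 \<le> e * \<delta>" using True \<delta> by (simp add: power2_eq_square mult_right_mono)
        then have "K * \<delta> + C * \<delta>\<^sup>2 \<le> K * \<delta> + C * (e * \<delta>)" using C by (simp add: mult_left_mono)
        also have "\<dots> \<le> (K + C * e + e) * \<delta>" using e \<delta> by (simp add: algebra_simps)
        finally show ?thesis .
      next
        case False
        then have "e * e \<le> e * \<delta>" using e by simp
        also have "\<dots> \<le> (K + C * e + e) * \<delta>" using K C e \<delta> by (intro mult_right_mono) auto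
        finally show ?thesis using h(2) by linarith
      qed
      then show ?thesis by (simp add: \<delta>_def)
    qed
    have "t - r = (\<Sum>i<N. h)" using N by (simp add: h_def)
    also have "\<dots> \<le> (\<Sum>i<N. (K + C * e + e) * (s (u (Suc i)) - s (u i)))"
      by (intro sum_mono step) simp
    also have "\<dots> = (K + C * e + e) * T"
      using sum_lessThan_telescope[of "\<lambda>i. s (u i)" N] by (simp add: sum_distrib_left[symmetric] uN T_def)
    finally show ?thesis .
  qed
  have "t - r \<le> K * T + \<epsilon>" if \<epsilon>: "\<epsilon> > 0" for \<epsilon>
  proof -
    define e where "e = \<epsilon> / ((C + 1) * T + 1)"
    have pos: "(C + 1) * T + 1 > 0" using C T by (simp add: add_nonneg_pos)
    then have e: "e > 0" using \<epsilon> by (simp add: e_def)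
    have "e * ((C + 1) * T) \<le> e * ((C + 1) * T + 1)" using e by simp
    also have "\<dots> = \<epsilon>" using pos by (simp add: e_def)
    finally have "e * ((C + 1) * T) \<le> \<epsilon>" .
    then show ?thesis using main[OF e] by (simp add: algebra_simps)
  qed
  then show ?thesis unfolding T_def by (rule field_le_epsilon)
qed

context o_minimal_structure
begin

lemma fibrewise_minimizers:
  fixes A :: "real \<Rightarrow> 'e::euclidean_space \<Rightarrow> bool" and \<phi> :: "'e \<Rightarrow> real"
  assumes A: "definable_pred (\<lambda>z. A (fst z) (snd z))" "\<And>r. compact {z. A r z}" "\<And>r. \<exists>z. A r z"
    and \<phi>: "definable_map \<phi>" "continuous_on UNIV \<phi>"
  defines "B \<equiv> \<lambda>r z. A r z \<and> (\<forall>z'. A r z' \<longrightarrow> \<phi> z \<le> \<phi> z')"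
  shows "definable_pred (\<lambda>z. B (fst z) (snd z))" "\<And>r. compact {z. B r z}" "\<And>r. \<exists>z. B r z"
proof -
  note intros = definable_intros definable_map_compose[OF \<phi>(1)] definable_rel[OF A(1)]
  show "definable_pred (\<lambda>z. B (fst z) (snd z))" unfolding B_def by (intro intros)
  have cont: "continuous_on X \<phi>" for X using \<phi>(2) by (rule continuous_on_subset) simp
  show ex: "\<exists>z. B r z" for r
    using continuous_attains_inf[OF A(2)[of r] _ cont] A(3)[of r] unfolding B_def by auto
  show "compact {z. B r z}" for r
  proof -
    obtain z0 where z0: "B r z0" using ex by blast
    have "{z. B r z} = {z. A r z} \<inter> {z. \<phi> z \<le> \<phi> z0}"
      using z0 unfolding B_def by (auto intro: order_trans)
    moreover have "closed {z. \<phi> z \<le> \<phi> z0}" using cont by (intro closed_Collect_le) auto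
    ultimately show ?thesis using A(2)[of r] by (simp add: compact_Int_closed)
  qed
qed

text \<open>Minimizing one coordinate after the other over the compact fibres leaves a single point in each of them.\<close>

lemma definable_selection:
  fixes A :: "real \<Rightarrow> 'e::euclidean_space \<Rightarrow> bool"
  assumes A: "definable_pred (\<lambda>z. A (fst z) (snd z))" "\<And>r. compact {z. A r z}" "\<And>r. \<exists>z. A r z"
  shows "\<exists>\<gamma>. definable_map \<gamma> \<and> (\<forall>r. A r (\<gamma> r))"
proof -
  have "\<exists>B. definable_pred (\<lambda>z. B (fst z) (snd z)) \<and> (\<forall>r. compact {z. B r z}) \<and> (\<forall>r. \<exists>z. B r z) \<and>
      (\<forall>r z. B r z \<longrightarrow> A r z) \<and> (\<forall>r z z'. B r z \<longrightarrow> B r z' \<longrightarrow> (\<forall>b\<in>I. z \<bullet> b = z' \<bullet> b))"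
    if "finite I" for I :: "'e set"
    using that
  proof (induction I)
    case empty
    show ?case using A by (intro exI[of _ A]) simp
  next
    case (insert b I)
    then obtain B where B: "definable_pred (\<lambda>z. B (fst z) (snd z))" "\<And>r. compact {z. B r z}" "\<And>r. \<exists>z. B r z"
      "\<And>r z. B r z \<Longrightarrow> A r z" "\<And>r z z'. B r z \<Longrightarrow> B r z' \<Longrightarrow> \<forall>b\<in>I. z \<bullet> b = z' \<bullet> b"
      by blast
    define B' where "B' r z \<longleftrightarrow> B r z \<and> (\<forall>z'. B r z' \<longrightarrow> z \<bullet> b \<le> z' \<bullet> b)" for r z
    have \<phi>: "definable_map (\<lambda>z. z \<bullet> b)" "continuous_on UNIV (\<lambda>z. z \<bullet> b)"
      by (intro definable_intros) (intro continuous_intros)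
    have "definable_pred (\<lambda>z. B' (fst z) (snd z))" "\<forall>r. compact {z. B' r z}" "\<forall>r. \<exists>z. B' r z"
      unfolding B'_def
      by (rule fibrewise_minimizers(1)[OF B(1,2,3) \<phi>],
          intro allI fibrewise_minimizers(2)[OF B(1,2,3) \<phi>],
          intro allI fibrewise_minimizers(3)[OF B(1,2,3) \<phi>])
    moreover have "\<forall>r z. B' r z \<longrightarrow> A r z" using B(4) unfolding B'_def by blast
    moreover have "\<forall>r z z'. B' r z \<longrightarrow> B' r z' \<longrightarrow> (\<forall>c\<in>insert b I. z \<bullet> c = z' \<bullet> c)"
    proof (intro allI impI ballI)
      fix r z z' c assume *: "B' r z" "B' r z'" "c \<in> insert b I"
      then have "z \<bullet> b = z' \<bullet> b" unfolding B'_def by (simp add: order_antisym)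
      moreover have "z \<bullet> c = z' \<bullet> c" if "c \<in> I" using B(5)[of r z z'] * that unfolding B'_def by blast
      ultimately show "z \<bullet> c = z' \<bullet> c" using *(3) by blast
    qed
    ultimately show ?case by blast
  qed
  from this[OF finite_Basis] obtain B where B: "definable_pred (\<lambda>z. B (fst z) (snd z))" "\<And>r. \<exists>z. B r z"
      "\<And>r z. B r z \<Longrightarrow> A r z" "\<And>r z z'. B r z \<Longrightarrow> B r z' \<Longrightarrow> \<forall>b\<in>Basis. z \<bullet> b = z' \<bullet> b"
    by blast
  obtain \<gamma> where \<gamma>: "\<And>r. B r (\<gamma> r)" using B(2) by metis
  have "B r z \<longleftrightarrow> z = \<gamma> r" for r z
    using \<gamma>[of r] B(4)[of r z "\<gamma> r"] by (auto intro: euclidean_eqI)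
  then have "definable_map \<gamma>" using B(1) by (simp add: definable_map_def)
  then show ?thesis using \<gamma> B(3) by blast
qed

text \<open>A bounded curve whose coordinates are monotone has finite length; \<open>s\<close> is the sum of the coordinates, with
  signs that make each of them increasing.\<close>

lemma definable_curve_arc_length:
  fixes \<gamma> :: "real \<Rightarrow> 'e::euclidean_space"
  assumes \<gamma>: "definable_map \<gamma>" and bound: "\<And>r. norm (\<gamma> r) \<le> R"
  obtains b s M where "b > c" "mono_on {c<..<b} s" "\<And>r. \<bar>s r\<bar> \<le> M"
    "\<And>r t. c < r \<Longrightarrow> r \<le> t \<Longrightarrow> t < b \<Longrightarrow> norm (\<gamma> t - \<gamma> r) \<le> s t - s r"
proof -
  have "\<exists>b. b > c \<and> (\<exists>\<epsilon>\<in>{1, - 1}. mono_on {c<..<b} (\<lambda>r. \<epsilon> * (\<gamma> r \<bullet> i)))" for i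
  proof -
    have "definable_map (\<lambda>r. \<gamma> r \<bullet> i)" by (intro definable_intros \<gamma>)
    from definable_mono_germ[OF this, of c] show ?thesis by simp
  qed
  then obtain b \<epsilon> where b: "\<And>i. b i > c" and \<epsilon>: "\<And>i. \<epsilon> i \<in> {1, - 1 :: real}"
    and mono: "\<And>i. mono_on {c<..<b i} (\<lambda>r. \<epsilon> i * (\<gamma> r \<bullet> i))"
    by metis
  define d where "d = Min (b ` (Basis :: 'e set))"
  have d: "d > c" "\<And>i. i \<in> Basis \<Longrightarrow> d \<le> b i"
    using b by (auto simp: d_def)
  define s where "s r = (\<Sum>i\<in>Basis. \<epsilon> i * (\<gamma> r \<bullet> i))" for r
  have length: "norm (\<gamma> t - \<gamma> r) \<le> s t - s r" if "c < r" "r \<le> t" "t < d" for r t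
  proof -
    have "norm (\<gamma> t - \<gamma> r) \<le> (\<Sum>i\<in>Basis. \<bar>(\<gamma> t - \<gamma> r) \<bullet> i\<bar>)" by (rule norm_le_l1)
    also have "\<dots> \<le> (\<Sum>i\<in>Basis. \<epsilon> i * (\<gamma> t \<bullet> i) - \<epsilon> i * (\<gamma> r \<bullet> i))"
    proof (rule sum_mono)
      fix i :: 'e assume "i \<in> Basis"
      then have "\<epsilon> i * (\<gamma> r \<bullet> i) \<le> \<epsilon> i * (\<gamma> t \<bullet> i)"
        using mono_onD[OF mono[of i], of r t] d(2)[of i] that by simp
      then show "\<bar>(\<gamma> t - \<gamma> r) \<bullet> i\<bar> \<le> \<epsilon> i * (\<gamma> t \<bullet> i) - \<epsilon> i * (\<gamma> r \<bullet> i)"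
        using \<epsilon>[of i] by (auto simp: inner_diff_left)
    qed
    also have "\<dots> = s t - s r" by (simp add: s_def sum_subtractf)
    finally show ?thesis .
  qed
  show ?thesis
  proof (rule that[OF d(1) _ _ length])
    show "mono_on {c<..<d} s"
    proof (rule mono_onI)
      fix r t assume "r \<in> {c<..<d}" "t \<in> {c<..<d}" "r \<le> t"
      then have "norm (\<gamma> t - \<gamma> r) \<le> s t - s r" by (intro length) auto
      then show "s r \<le> s t" using norm_ge_zero[of "\<gamma> t - \<gamma> r"] by linarith
    qed
    show "\<bar>s r\<bar> \<le> (\<Sum>i\<in>(Basis :: 'e set). R)" for r
      unfolding s_def
    proof (rule order_trans[OF sum_abs sum_mono])
      fix i :: 'e assume "i \<in> Basis"
      then have "\<bar>\<gamma> r \<bullet> i\<bar> \<le> R" using Basis_le_norm[of i "\<gamma> r"] bound[of r] by simp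
      then show "\<bar>\<epsilon> i * (\<gamma> r \<bullet> i)\<bar> \<le> R" using \<epsilon>[of i] by (auto simp: abs_mult)
    qed
  qed
qed

text \<open>The function \<open>\<sigma>\<close> bounds the slope of \<open>V\<close> on \<open>A\<close>. The first alternative
  says that \<open>\<sigma>\<close> stays away from 0 on the levels slightly above \<open>c\<close>; it includes the
  case that these levels are empty. Otherwise \<open>s\<close> is the arc length in the 1-norm, up to a constant, along
  a curve \<open>\<gamma>\<close> that runs through the levels and minimizes \<open>\<sigma>\<close> on each. The
  minimal value \<open>\<psi> r = \<sigma> (\<gamma> r)\<close> is monotone near \<open>c\<close>. If it increases,
  then it is at most \<open>\<sigma> z\<close> on all levels below that of \<open>z\<close>, and the slope bound along
  \<open>\<gamma>\<close> can be added up.\<close>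

theorem definable_desingularization:
  fixes A :: "'e::euclidean_space set" and V \<sigma> :: "'e \<Rightarrow> real"
  assumes A: "compact A" "definable_set S A"
    and V: "definable_map V" "continuous_on UNIV V"
    and \<sigma>: "definable_map \<sigma>" "continuous_on UNIV \<sigma>" "\<And>z. \<sigma> z \<ge> 0"
    and C: "C \<ge> 0"
    and slope: "\<And>z z'. z \<in> A \<Longrightarrow> z' \<in> A \<Longrightarrow> V z' - V z \<le> C * (\<sigma> z * norm (z' - z) + (norm (z' - z))\<^sup>2)"
  shows "(\<exists>b>c. \<exists>m>0. \<forall>z\<in>A. c < V z \<and> V z < b \<longrightarrow> m \<le> \<sigma> z) \<or>
    (\<exists>b>c. \<exists>s M. mono_on {c<..<b} s \<and> (\<forall>r. \<bar>s r\<bar> \<le> M) \<and>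
      (\<forall>z\<in>A. \<forall>r. c < r \<and> r \<le> V z \<and> V z < b \<longrightarrow> V z - r \<le> C * \<sigma> z * (s (V z) - s r)))"
    (is "?bounded_below \<or> ?desingularized")
proof -
  have A_pred: "definable_pred (\<lambda>z. z \<in> A)" using A(2) by (simp add: definable_pred_def)
  define ne where "ne r \<longleftrightarrow> (\<exists>z. z \<in> A \<and> V z = r)" for r
  have ne_pred: "definable_pred ne"
    unfolding ne_def
    by (intro definable_intros definable_map_compose[OF V(1)] definable_pred_vimage[of snd, OF _ A_pred])
  then consider "\<forall>\<^sub>F r in at_right c. ne r" | "\<forall>\<^sub>F r in at_right c. \<not> ne r"
    using definable_pred_germ[of ne c] by blast
  then show ?thesis
  proof cases
    case 2
    then obtain b where "c < b" "\<And>r. c < r \<Longrightarrow> r < b \<Longrightarrow> \<not> ne r"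
      by (auto simp: eventually_at_right_field)
    then have ?bounded_below by (intro exI[of _ b] conjI exI[of _ 1]) (auto simp: ne_def)
    then show ?thesis ..
  next
    case 1
    then obtain b\<^sub>0 where b\<^sub>0: "c < b\<^sub>0" "\<And>r. c < r \<Longrightarrow> r < b\<^sub>0 \<Longrightarrow> ne r"
      by (auto simp: eventually_at_right_field)
    \<comment> \<open>The value 0 makes the fibres over empty levels nonempty, as a selection on all of the reals requires.\<close>
    define L where "L r z \<longleftrightarrow> z \<in> A \<and> V z = r \<or> \<not> ne r \<and> z = 0" for r z
    have L_cpt: "compact {z. L r z}" for r
    proof (cases "ne r")
      case True
      then have "{z. L r z} = A \<inter> {z. V z = r}" by (auto simp: L_def)
      moreover have "closed {z. V z = r}" using V(2) by (intro closed_Collect_eq) auto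
      ultimately show ?thesis using A(1) by (simp add: compact_Int_closed)
    next
      case False
      then have "{z. L r z} = {0}" by (auto simp: L_def ne_def)
      then show ?thesis by simp
    qed
    have L_ne: "\<exists>z. L r z" for r unfolding L_def ne_def by blast
    have L_pred: "definable_pred (\<lambda>w. L (fst w) (snd w))"
      unfolding L_def
      by (intro definable_intros definable_map_compose[OF V(1)] definable_pred_vimage[of snd, OF _ A_pred]
          definable_pred_vimage[of fst, OF _ ne_pred])
    obtain \<gamma> where \<gamma>: "definable_map \<gamma>" "\<And>r. L r (\<gamma> r)" "\<And>r z. L r z \<Longrightarrow> \<sigma> (\<gamma> r) \<le> \<sigma> z"
      using definable_selection[OF fibrewise_minimizers[OF L_pred L_cpt L_ne \<sigma>(1,2)]] by blast
    have on_level: "\<gamma> r \<in> A" "V (\<gamma> r) = r" if "c < r" "r < b\<^sub>0" for r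
      using \<gamma>(2)[of r] b\<^sub>0(2)[OF that] by (auto simp: L_def)
    have least: "\<sigma> (\<gamma> (V z)) \<le> \<sigma> z" if "z \<in> A" for z
      using that by (intro \<gamma>(3)) (auto simp: L_def)
    obtain R where R: "\<And>z. z \<in> A \<Longrightarrow> norm z \<le> R"
      using compact_imp_bounded[OF A(1)] by (auto simp: bounded_iff)
    have "norm (\<gamma> r) \<le> max R 0" for r
      using \<gamma>(2)[of r] R[of "\<gamma> r"] by (auto simp: L_def)
    from definable_curve_arc_length[OF \<gamma>(1) this] obtain b\<^sub>1 s M where b\<^sub>1: "b\<^sub>1 > c"
      and s: "mono_on {c<..<b\<^sub>1} s" "\<And>r. \<bar>s r\<bar> \<le> M"
        "\<And>r t. c < r \<Longrightarrow> r \<le> t \<Longrightarrow> t < b\<^sub>1 \<Longrightarrow> norm (\<gamma> t - \<gamma> r) \<le> s t - s r"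
      by blast
    define \<psi> where "\<psi> r = \<sigma> (\<gamma> r)" for r
    have "definable_map \<psi>" unfolding \<psi>_def by (rule definable_map_compose[OF \<sigma>(1) \<gamma>(1)])
    then obtain b\<^sub>2 where b\<^sub>2: "b\<^sub>2 > c" "mono_on {c<..<b\<^sub>2} \<psi> \<or> mono_on {c<..<b\<^sub>2} (\<lambda>r. - \<psi> r)"
      using definable_mono_germ[of \<psi> c] by blast
    show ?thesis
    proof (cases "mono_on {c<..<b\<^sub>2} \<psi>")
      case False
      then have anti: "\<psi> t \<le> \<psi> r" if "c < r" "r \<le> t" "t < b\<^sub>2" for r t
        using b\<^sub>2(2) mono_onD[of "{c<..<b\<^sub>2}" "\<lambda>r. - \<psi> r" r t] that by auto
      have "\<exists>u. c < u \<and> u < b\<^sub>2 \<and> \<psi> u \<noteq> 0"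
      proof (rule ccontr)
        assume "\<not> ?thesis"
        then have "mono_on {c<..<b\<^sub>2} \<psi>" by (intro mono_onI) simp
        with False show False ..
      qed
      \<comment> \<open>A decreasing \<open>\<psi>\<close> that is not increasing is positive somewhere, hence bounded below closer to
        \<open>c\<close>.\<close>
      then obtain u where u: "c < u" "u < b\<^sub>2" "\<psi> u \<noteq> 0" by (elim exE conjE) (rule that)
      then have "\<psi> u > 0" using \<sigma>(3)[of "\<gamma> u"] by (simp add: \<psi>_def)
      moreover have "\<psi> u \<le> \<sigma> z" if "z \<in> A" "c < V z" "V z < u" for z
        using anti[of "V z" u] least[of z] that u by (simp add: \<psi>_def)
      ultimately have ?bounded_below using u(1) by blast
      then show ?thesis ..
    next
      case True
      define b where "b = min b\<^sub>0 (min b\<^sub>1 b\<^sub>2)"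
      have b: "c < b" "b \<le> b\<^sub>0" "b \<le> b\<^sub>1" "b \<le> b\<^sub>2" using b\<^sub>0 b\<^sub>1 b\<^sub>2 by (auto simp: b_def)
      have "V z - r \<le> C * \<sigma> z * (s (V z) - s r)"
        if z: "z \<in> A" and r: "c < r" "r \<le> V z" "V z < b" for z r
      proof (rule increment_bound_by_subdivision[OF r(2) _ C])
        show "0 \<le> C * \<sigma> z" using C \<sigma>(3) by simp
        fix u v assume uv: "r \<le> u" "u \<le> v" "v \<le> V z"
        then have in_range: "c < u" "c < v" "v < b\<^sub>0" "u < b\<^sub>0" "v < b\<^sub>1" "V z < b\<^sub>2" using r b by linarith+
        have len: "norm (\<gamma> v - \<gamma> u) \<le> s v - s u" using s(3) uv in_range by simp
        then show "s u \<le> s v" using norm_ge_zero[of "\<gamma> v - \<gamma> u"] by linarith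
        have "\<psi> u \<le> \<psi> (V z)" using mono_onD[OF True, of u "V z"] uv in_range by simp
        then have \<sigma>u: "\<sigma> (\<gamma> u) \<le> \<sigma> z" using least[OF z] by (simp add: \<psi>_def)
        have "v - u \<le> C * (\<sigma> (\<gamma> u) * norm (\<gamma> v - \<gamma> u) + (norm (\<gamma> v - \<gamma> u))\<^sup>2)"
          using slope[OF on_level(1)[of u] on_level(1)[of v]] on_level(2)[of u] on_level(2)[of v] in_range by simp
        also have "\<dots> \<le> C * (\<sigma> z * (s v - s u) + (s v - s u)\<^sup>2)"
          using len \<sigma>u \<sigma>(3) C by (intro mult_left_mono add_mono mult_mono power_mono) auto
        finally show "v - u \<le> C * \<sigma> z * (s v - s u) + C * (s v - s u)\<^sup>2"
          by (simp add: algebra_simps)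
      qed
      moreover have "mono_on {c<..<b} s" using s(1) by (rule mono_on_subset) (use b in auto)
      ultimately have ?desingularized using b(1) s(2) by blast
      then show ?thesis ..
    qed
  qed
qed

end

section \<open>Definability of derivatives\<close>

text \<open>The directional derivative is the only vector that satisfies the defining condition \<open>?Q\<close> on one-sided
  difference quotients, a first-order formula over the graph of \<open>F\<close>.\<close>

lemma (in o_minimal_structure) definable_map_derivative:
  fixes F :: "'a::euclidean_space \<Rightarrow> 'b::euclidean_space"
  assumes F: "definable_map F" and deriv: "\<And>x. (F has_derivative F' x) (at x)"
  shows "definable_map (\<lambda>z. F' (fst z) (snd z))"
proof -
  let ?Q = "\<lambda>x d w. \<forall>e. 0 < e \<longrightarrow> (\<exists>\<delta>. 0 < \<delta> \<and> (\<forall>t. 0 < t \<longrightarrow> t < \<delta> \<longrightarrow>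
      norm (F (x + t *\<^sub>R d) - F x - t *\<^sub>R w) \<le> e * t))"
  have Q: "?Q x d (F' x d)" for x d
  proof (intro allI impI)
    fix e :: real assume e: "0 < e"
    have lin: "linear (F' x)" using deriv[of x] by (rule has_derivative_linear)
    define e' where "e' = e / (norm d + 1)"
    have "e' > 0" using e by (simp add: e'_def add_nonneg_pos)
    then obtain \<delta> where \<delta>: "\<delta> > 0" "\<And>y. norm (y - x) < \<delta> \<Longrightarrow> norm (F y - F x - F' x (y - x)) \<le> e' * norm (y - x)"
      using deriv[of x] unfolding has_derivative_at_alt by blast
    show "\<exists>\<delta>. 0 < \<delta> \<and> (\<forall>t. 0 < t \<longrightarrow> t < \<delta> \<longrightarrow> norm (F (x + t *\<^sub>R d) - F x - t *\<^sub>R F' x d) \<le> e * t)"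
    proof (intro exI[of _ "\<delta> / (norm d + 1)"] conjI allI impI)
      show "0 < \<delta> / (norm d + 1)" using \<delta>(1) by (simp add: add_nonneg_pos)
      fix t :: real assume t: "0 < t" "t < \<delta> / (norm d + 1)"
      have pos: "norm d + 1 > 0" by (simp add: add_nonneg_pos)
      have "t * norm d \<le> t * (norm d + 1)" using t(1) by simp
      also have "\<dots> < \<delta>" using t(2) pos by (simp add: field_simps)
      finally have "norm (F (x + t *\<^sub>R d) - F x - F' x (t *\<^sub>R d)) \<le> e' * norm (t *\<^sub>R d)"
        using \<delta>(2)[of "x + t *\<^sub>R d"] t(1) by simp
      also have "\<dots> = t * (e' * norm d)" using t(1) by simp
      also have "e' * norm d \<le> e" using e pos by (simp add: e'_def field_simps)
      finally show "norm (F (x + t *\<^sub>R d) - F x - t *\<^sub>R F' x d) \<le> e * t"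
        using t(1) by (simp add: linear_cmul[OF lin] mult.commute)
    qed
  qed
  have unique: "w = w'" if w: "?Q x d w" "?Q x d w'" for x d w w'
  proof (rule ccontr)
    assume "w \<noteq> w'"
    define e where "e = norm (w - w') / 3"
    have e: "e > 0" using \<open>w \<noteq> w'\<close> by (simp add: e_def)
    obtain \<delta> where \<delta>: "\<delta> > 0" "\<And>t. 0 < t \<Longrightarrow> t < \<delta> \<Longrightarrow> norm (F (x + t *\<^sub>R d) - F x - t *\<^sub>R w) \<le> e * t"
      using w(1) e by blast
    obtain \<delta>' where \<delta>': "\<delta>' > 0" "\<And>t. 0 < t \<Longrightarrow> t < \<delta>' \<Longrightarrow> norm (F (x + t *\<^sub>R d) - F x - t *\<^sub>R w') \<le> e * t"
      using w(2) e by blast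
    obtain t where t: "0 < t" "t < min \<delta> \<delta>'" using dense[of 0 "min \<delta> \<delta>'"] \<delta>(1) \<delta>'(1) by auto
    have "t * norm (w - w') = norm ((F (x + t *\<^sub>R d) - F x - t *\<^sub>R w') - (F (x + t *\<^sub>R d) - F x - t *\<^sub>R w))"
      using t(1) by (simp add: scaleR_diff_right[symmetric])
    also have "\<dots> \<le> e * t + e * t"
      using \<delta>(2)[of t] \<delta>'(2)[of t] t norm_triangle_ineq4 by (smt (verit) min_less_iff_conj)
    finally have "t * norm (w - w') \<le> t * (2 * e)" by (simp add: algebra_simps)
    then have "norm (w - w') \<le> 2 * e" using t(1) by simp
    then show False using e by (simp add: e_def)
  qed
  have "definable_pred (\<lambda>z :: ('a \<times> 'a) \<times> 'b. ?Q (fst (fst z)) (snd (fst z)) (snd z))"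
    by (intro definable_intros definable_map_norm definable_map_compose[OF F])
  also have "(\<lambda>z :: ('a \<times> 'a) \<times> 'b. ?Q (fst (fst z)) (snd (fst z)) (snd z))
      = (\<lambda>z. snd z = F' (fst (fst z)) (snd (fst z)))"
    using Q unique by (intro ext iffI) simp_all
  finally show ?thesis by (simp add: definable_map_def)
qed

section \<open>Sequences of finite length\<close>

text \<open>By the inequality of arithmetic and geometric means, the hypothesis on three consecutive iterates gives
  \<open>2 \<sigma>\<^bsub>k+1\<^esub> \<le> \<sigma>\<^sub>k + K (\<phi>\<^sub>k - \<phi>\<^bsub>k+1\<^esub>)\<close>,
  which telescopes. It is assumed only near the cluster point, so boundedness of the length and confinement to the unit
  ball are proved by one induction, started where the iterate is close to \<open>c\<close> and the remaining length is
  small.\<close>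

lemma finite_length_convergence:
  fixes x :: "nat \<Rightarrow> 'a::banach" and \<phi> :: "nat \<Rightarrow> real"
  assumes cluster: "strict_mono r" "(x \<circ> r) \<longlonglongrightarrow> c"
    and steps: "(\<lambda>k. norm (x (Suc k) - x k)) \<longlonglongrightarrow> 0"
    and \<phi>: "\<And>k. k \<ge> k\<^sub>1 \<Longrightarrow> \<phi> (Suc k) \<le> \<phi> k" "\<And>k. \<bar>\<phi> k\<bar> \<le> B"
    and K: "K \<ge> 0"
    and descent: "\<And>k. k \<ge> k\<^sub>1 \<Longrightarrow> x k \<in> cball c 1 \<Longrightarrow>
      (norm (x (Suc (Suc k)) - x (Suc k)))\<^sup>2 \<le> K * norm (x (Suc k) - x k) * (\<phi> k - \<phi> (Suc k))"
  shows "x \<longlonglongrightarrow> c" "summable (\<lambda>k. norm (x (Suc k) - x k))"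
proof -
  define \<sigma> where "\<sigma> k = norm (x (Suc k) - x k)" for k
  have \<phi>_mono: "\<phi> l \<le> \<phi> k" if "k\<^sub>1 \<le> k" "k \<le> l" for k l
    using that(2,1) by (induction l rule: dec_induct) (auto intro: order_trans[OF \<phi>(1)])
  define \<psi> where "\<psi> k = \<phi> (k + k\<^sub>1)" for k
  have "decseq \<psi>" unfolding decseq_def \<psi>_def using \<phi>_mono by simp
  moreover have "\<forall>i. - B \<le> \<psi> i" using \<phi>(2) by (simp add: \<psi>_def abs_le_iff minus_le_iff)
  ultimately obtain q where "\<psi> \<longlonglongrightarrow> q" and "\<forall>i. q \<le> \<psi> i" by (rule decseq_convergent)
  then have \<phi>_lim: "\<phi> \<longlonglongrightarrow> q" unfolding \<psi>_def by (simp add: LIMSEQ_offset)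
  have \<phi>_ge: "q \<le> \<phi> k" if "k \<ge> k\<^sub>1" for k
    using \<open>\<forall>i. q \<le> \<psi> i\<close>[rule_format, of "k - k\<^sub>1"] that by (simp add: \<psi>_def)
  have half: "2 * \<sigma> (Suc k) \<le> \<sigma> k + K * (\<phi> k - \<phi> (Suc k))" if k: "k \<ge> k\<^sub>1" "x k \<in> cball c 1" for k
  proof -
    let ?a = "\<sigma> k" and ?b = "K * (\<phi> k - \<phi> (Suc k))"
    have b: "?b \<ge> 0" using K \<phi>(1)[OF k(1)] by simp
    have "(\<sigma> (Suc k))\<^sup>2 \<le> ?a * ?b" using descent[OF k] by (simp add: \<sigma>_def mult_ac)
    then have "(2 * \<sigma> (Suc k))\<^sup>2 \<le> 4 * (?a * ?b)" by (simp add: power_mult_distrib)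
    also have "\<dots> \<le> (?a + ?b)\<^sup>2"
      using zero_le_power2[of "?a - ?b"] by (simp add: power2_sum power2_diff algebra_simps)
    finally have "(2 * \<sigma> (Suc k))\<^sup>2 \<le> (?a + ?b)\<^sup>2" .
    then show ?thesis by (rule power2_le_imp_le) (use b in \<open>simp add: \<sigma>_def\<close>)
  qed
  have "\<forall>\<^sub>F n in sequentially. norm (x (r n) - c) < 1 / 4 \<and> \<sigma> (r n) < 1 / 8 \<and> K * (\<phi> (r n) - q) < 1 / 4 \<and> r n \<ge> k\<^sub>1"
  proof (intro eventually_conj)
    have "(\<lambda>n. norm (x (r n) - c)) \<longlonglongrightarrow> 0"
      using cluster(2) by (simp add: o_def tendsto_norm_zero LIM_zero)
    then show "\<forall>\<^sub>F n in sequentially. norm (x (r n) - c) < 1 / 4" by (rule order_tendstoD) simp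
    have "(\<sigma> \<circ> r) \<longlonglongrightarrow> 0"
      using LIMSEQ_subseq_LIMSEQ[OF steps cluster(1)] by (simp add: \<sigma>_def o_def)
    then show "\<forall>\<^sub>F n in sequentially. \<sigma> (r n) < 1 / 8"
      unfolding o_def by (rule order_tendstoD) simp
    have "(\<lambda>n. K * (\<phi> (r n) - q)) \<longlonglongrightarrow> K * (q - q)"
      using LIMSEQ_subseq_LIMSEQ[OF \<phi>_lim cluster(1)] unfolding o_def by (intro tendsto_intros)
    then show "\<forall>\<^sub>F n in sequentially. K * (\<phi> (r n) - q) < 1 / 4" by (rule order_tendstoD) simp
    show "\<forall>\<^sub>F n in sequentially. r n \<ge> k\<^sub>1"
      using eventually_ge_at_top[of k\<^sub>1] by (rule eventually_mono) (use seq_suble[OF cluster(1)] le_trans in blast)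
  qed
  then obtain n where "norm (x (r n) - c) < 1 / 4 \<and> \<sigma> (r n) < 1 / 8 \<and> K * (\<phi> (r n) - q) < 1 / 4 \<and> r n \<ge> k\<^sub>1"
    using eventually_happens by (metis (mono_tags, lifting) trivial_limit_sequentially)
  then obtain k\<^sub>0 where k\<^sub>0: "norm (x k\<^sub>0 - c) < 1 / 4" "\<sigma> k\<^sub>0 < 1 / 8" "K * (\<phi> k\<^sub>0 - q) < 1 / 4" "k\<^sub>0 \<ge> k\<^sub>1"
    by blast
  have length: "(\<Sum>i\<le>n. \<sigma> (k\<^sub>0 + i)) + \<sigma> (k\<^sub>0 + n) \<le> 2 * \<sigma> k\<^sub>0 + K * (\<phi> k\<^sub>0 - \<phi> (k\<^sub>0 + n)) \<and>
      x (k\<^sub>0 + n) \<in> cball c 1 \<and> norm (x (Suc (k\<^sub>0 + n)) - x k\<^sub>0) \<le> (\<Sum>i\<le>n. \<sigma> (k\<^sub>0 + i))" for n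
  proof (induction n)
    case 0
    show ?case using k\<^sub>0(1) by (simp add: \<sigma>_def dist_norm norm_minus_commute)
  next
    case (Suc n)
    let ?k = "k\<^sub>0 + n"
    have "K * (\<phi> k\<^sub>0 - \<phi> ?k) \<le> K * (\<phi> k\<^sub>0 - q)" using \<phi>_ge[of ?k] k\<^sub>0(4) K by (intro mult_left_mono) auto
    moreover have "\<sigma> ?k \<ge> 0" by (simp add: \<sigma>_def)
    ultimately have "norm (x (Suc ?k) - x k\<^sub>0) \<le> 1 / 2" using Suc.IH k\<^sub>0 by linarith
    then have "x (k\<^sub>0 + Suc n) \<in> cball c 1"
      using k\<^sub>0(1) norm_triangle_ineq[of "x (Suc ?k) - x k\<^sub>0" "x k\<^sub>0 - c"] by (simp add: dist_norm norm_minus_commute)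
    moreover have "2 * \<sigma> (Suc ?k) \<le> \<sigma> ?k + K * (\<phi> ?k - \<phi> (Suc ?k))"
      using Suc.IH k\<^sub>0(4) by (intro half) auto
    moreover have "norm (x (Suc (k\<^sub>0 + Suc n)) - x k\<^sub>0) \<le> norm (x (Suc ?k) - x k\<^sub>0) + \<sigma> (Suc ?k)"
      using norm_triangle_ineq[of "x (Suc ?k) - x k\<^sub>0" "x (Suc (Suc ?k)) - x (Suc ?k)"]
      by (simp add: \<sigma>_def algebra_simps)
    ultimately show ?case using Suc.IH by (simp add: algebra_simps)
  qed
  have "summable (\<lambda>i. \<sigma> (i + k\<^sub>0))"
  proof (rule summableI_nonneg_bounded)
    fix n
    have "(\<Sum>i<n. \<sigma> (i + k\<^sub>0)) \<le> (\<Sum>i\<le>n. \<sigma> (k\<^sub>0 + i))"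
      by (subst add.commute) (intro sum_mono2, auto simp: \<sigma>_def)
    also have "\<dots> \<le> 2 * \<sigma> k\<^sub>0 + K * (\<phi> k\<^sub>0 - q)"
    proof -
      have "K * (\<phi> k\<^sub>0 - \<phi> (k\<^sub>0 + n)) \<le> K * (\<phi> k\<^sub>0 - q)"
        using \<phi>_ge[of "k\<^sub>0 + n"] k\<^sub>0(4) K by (intro mult_left_mono) auto
      moreover have "\<sigma> (k\<^sub>0 + n) \<ge> 0" by (simp add: \<sigma>_def)
      ultimately show ?thesis using length[of n] by linarith
    qed
    finally show "(\<Sum>i<n. \<sigma> (i + k\<^sub>0)) \<le> 2 * \<sigma> k\<^sub>0 + K * (\<phi> k\<^sub>0 - q)" .
  qed (simp add: \<sigma>_def)
  then have summable: "summable \<sigma>" by (simp add: summable_iff_shift)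
  then show "summable (\<lambda>k. norm (x (Suc k) - x k))" by (simp add: \<sigma>_def[abs_def])
  then have "summable (\<lambda>k. x (Suc k) - x k)" by (rule summable_norm_cancel)
  then have "convergent (\<lambda>n. \<Sum>k<n. x (Suc k) - x k)" by (simp add: summable_iff_convergent)
  then obtain l where "(\<lambda>n. x n - x 0) \<longlonglongrightarrow> l"
    unfolding sum_lessThan_telescope by (auto simp: convergent_def)
  then have lim: "x \<longlonglongrightarrow> l + x 0" using tendsto_add[OF _ tendsto_const, of "\<lambda>n. x n - x 0" l _ "x 0"] by simp
  then have "(x \<circ> r) \<longlonglongrightarrow> l + x 0" by (rule LIMSEQ_subseq_LIMSEQ[OF _ cluster(1)])
  then have "l + x 0 = c" using cluster(2) by (rule LIMSEQ_unique)
  then show "x \<longlonglongrightarrow> c" using lim by simp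
qed

section \<open>The convex model of a composite problem\<close>

lemma norm_components_le: "norm (fst z) \<le> norm z" "norm (snd z) \<le> norm z"
  for z :: "'a::real_normed_vector \<times> 'b::real_normed_vector"
  using norm_fst_le[of "fst z" "snd z"] norm_snd_le[of "snd z" "fst z"] by simp_all

lemma continuous_on_compact_bound:
  fixes f :: "'a::topological_space \<Rightarrow> 'b::real_normed_vector"
  assumes "compact K" "continuous_on K f"
  shows "\<exists>B\<ge>0. \<forall>x\<in>K. norm (f x) \<le> B"
proof -
  have "bounded (f ` K)" using assms by (intro compact_imp_bounded compact_continuous_image)
  then obtain B where "\<forall>x\<in>K. norm (f x) \<le> B" unfolding bounded_iff by blast
  then show ?thesis by (intro exI[of _ "max B 0"]) (auto intro: order_trans)
qed

lemma cancel_norm_factor: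
  fixes a n B :: real
  assumes "a * n\<^sup>2 \<le> B * n" "n \<ge> 1"
  shows "a * n \<le> B"
  using assms by (intro mult_right_le_imp_le[of "a * n" n B]) (simp_all add: power2_eq_square mult.assoc)

text \<open>Prolonging the segment from \<open>u\<close> to \<open>v\<close> by a unit vector stays in a larger ball, on which
  \<open>g\<close> is bounded; convexity along the prolonged segment bounds the increment of \<open>g\<close>.\<close>

lemma convex_on_UNIV_Lipschitz_on_ball:
  fixes g :: "'a::euclidean_space \<Rightarrow> real"
  assumes "convex_on UNIV g"
  shows "\<exists>L\<ge>0. \<forall>u\<in>cball 0 R. \<forall>v\<in>cball 0 R. g v - g u \<le> L * norm (v - u)"
proof -
  have "continuous_on (cball 0 (R + 1)) g"
    by (rule continuous_on_subset[OF convex_on_continuous[OF open_UNIV assms]]) simp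
  from continuous_on_compact_bound[OF compact_cball this]
  obtain B where "\<forall>u\<in>cball 0 (R + 1). norm (g u) \<le> B" by blast
  then have B: "\<bar>g u\<bar> \<le> B" if "norm u \<le> R + 1" for u using that by simp
  have "g v - g u \<le> max 0 (2 * B) * norm (v - u)" if u: "norm u \<le> R" and v: "norm v \<le> R" for u v
  proof (cases "u = v")
    case False
    define d where "d = norm (v - u)"
    define w where "w = v + (1 / d) *\<^sub>R (v - u)"
    have d: "d > 0" using False by (simp add: d_def)
    have "norm w \<le> norm v + norm ((1 / d) *\<^sub>R (v - u))" unfolding w_def by (rule norm_triangle_ineq)
    also have "norm ((1 / d) *\<^sub>R (v - u)) = 1" using d by (simp add: d_def)
    finally have w: "norm w \<le> R + 1" using v by simp
    define t where "t = d / (1 + d)"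
    have t: "0 \<le> t" "t \<le> 1" "t \<le> d" using d by (simp_all add: t_def field_simps)
    have "v = (1 - t) *\<^sub>R u + t *\<^sub>R w"
    proof -
      have "(1 + d) *\<^sub>R ((1 - t) *\<^sub>R u + t *\<^sub>R w) = u + d *\<^sub>R w"
        using d by (simp add: t_def scaleR_right_distrib field_simps)
      also have "\<dots> = (1 + d) *\<^sub>R v"
        using d by (simp add: w_def scaleR_right_distrib algebra_simps)
      finally show ?thesis using d by simp
    qed
    then have "g v \<le> (1 - t) * g u + t * g w"
      using convex_onD[OF assms t(1,2), of u w] by simp
    then have "g v - g u \<le> t * (g w - g u)" by (simp add: algebra_simps)
    also have "\<dots> \<le> t * max 0 (2 * B)"
      using B[of u] B[OF w] u t(1) by (intro mult_left_mono) auto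
    also have "\<dots> \<le> d * max 0 (2 * B)" using t(3) by (intro mult_right_mono) auto
    finally show ?thesis by (simp add: d_def mult.commute)
  qed simp
  then show ?thesis by (intro exI[of _ "max 0 (2 * B)"]) simp
qed

locale composite_problem =
  fixes F :: "real^'n \<Rightarrow> real^'m" and g :: "real^'m \<Rightarrow> real" and D :: "(real^'n) set"
  assumes F_C2: "C2 F" and g_convex: "convex_on UNIV g"
    and D_convex: "convex D" and D_closed: "closed D"
begin

abbreviation lin :: "real^'n \<Rightarrow> real^'n \<Rightarrow> real^'m" where
  "lin x y \<equiv> F x + jacobian F (at x) *v (y - x)"

abbreviation model :: "real^'n \<Rightarrow> real \<Rightarrow> real^'n \<Rightarrow> real" where
  "model \<equiv> gn_model F g"

definition model_minimizer :: "real^'n \<Rightarrow> real \<Rightarrow> real^'n \<Rightarrow> bool" where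
  "model_minimizer x \<mu> y \<longleftrightarrow> y \<in> D \<and> (\<forall>y'\<in>D. model x \<mu> y \<le> model x \<mu> y')"

lemma model_self: "model x \<mu> x = g (F x)"
  by (simp add: gn_model_def)

lemma derivative_blinfun:
  obtains F' :: "real^'n \<Rightarrow> (real^'n) \<Rightarrow>\<^sub>L (real^'m)"
  where "\<And>x. (F has_derivative blinfun_apply (F' x)) (at x)"
    and "\<And>x v. jacobian F (at x) *v v = F' x v"
    and "continuous_on UNIV F'"
    and "\<And>c R. \<exists>\<Lambda>\<ge>0. \<forall>x\<in>cball c R. \<forall>y\<in>cball c R. norm (F' x - F' y) \<le> \<Lambda> * norm (x - y)"
proof -
  obtain F' :: "real^'n \<Rightarrow> (real^'n) \<Rightarrow>\<^sub>L (real^'m)" and F'' where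
    F': "\<And>x. (F has_derivative blinfun_apply (F' x)) (at x)" and
    F'': "\<And>x. (F' has_derivative blinfun_apply (F'' x)) (at x)" "continuous_on UNIV F''"
    using F_C2 unfolding C2_def by blast
  show ?thesis
  proof (rule that[OF F'])
    fix x v
    have "F differentiable at x" using F' by (auto simp: differentiable_def)
    then have "(F has_derivative (*v) (jacobian F (at x))) (at x)" by (simp add: jacobian_works)
    from has_derivative_unique[OF this F'] show "jacobian F (at x) *v v = F' x v" by metis
  next
    show "continuous_on UNIV F'"
      using F''(1) by (meson continuous_at_imp_continuous_on has_derivative_continuous)
  next
    fix c R
    have "continuous_on (cball c R) F''" by (rule continuous_on_subset[OF F''(2)]) simp
    from continuous_on_compact_bound[OF compact_cball this]
    obtain \<Lambda> where \<Lambda>: "\<And>x. x \<in> cball c R \<Longrightarrow> norm (F'' x) \<le> \<Lambda>" by blast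
    have "norm (F' x - F' y) \<le> max 0 \<Lambda> * norm (x - y)" if "x \<in> cball c R" "y \<in> cball c R" for x y
    proof (rule differentiable_bound[OF convex_cball _ _ that])
      fix z assume z: "z \<in> cball c R"
      show "(F' has_derivative blinfun_apply (F'' z)) (at z within cball c R)"
        using F''(1) by (rule has_derivative_at_withinI)
      show "onorm (blinfun_apply (F'' z)) \<le> max 0 \<Lambda>"
        using \<Lambda>[OF z] by (simp add: norm_blinfun.rep_eq)
    qed
    then show "\<exists>\<Lambda>\<ge>0. \<forall>x\<in>cball c R. \<forall>y\<in>cball c R. norm (F' x - F' y) \<le> \<Lambda> * norm (x - y)"
      by (intro exI[of _ "max 0 \<Lambda>"]) auto
  qed
qed

lemma Taylor_bounds:
  obtains \<Lambda> where "\<Lambda> \<ge> 0"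
    and "\<And>x y v. x \<in> cball c R \<Longrightarrow> y \<in> cball c R \<Longrightarrow>
      norm (jacobian F (at y) *v v - jacobian F (at x) *v v) \<le> \<Lambda> * norm (y - x) * norm v"
    and "\<And>x y. x \<in> cball c R \<Longrightarrow> y \<in> cball c R \<Longrightarrow> norm (F y - lin x y) \<le> \<Lambda> * (norm (y - x))\<^sup>2"
proof -
  obtain F' :: "real^'n \<Rightarrow> (real^'n) \<Rightarrow>\<^sub>L (real^'m)"
    where F': "\<And>x. (F has_derivative blinfun_apply (F' x)) (at x)"
    and jac: "\<And>x v. jacobian F (at x) *v v = F' x v"
    and "continuous_on UNIV F'"
    and Lip: "\<And>c R. \<exists>\<Lambda>\<ge>0. \<forall>x\<in>cball c R. \<forall>y\<in>cball c R. norm (F' x - F' y) \<le> \<Lambda> * norm (x - y)"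
    by (rule derivative_blinfun) (rule that)
  from Lip[of c R] obtain \<Lambda> where \<Lambda>: "\<Lambda> \<ge> 0"
    "\<And>x y. x \<in> cball c R \<Longrightarrow> y \<in> cball c R \<Longrightarrow> norm (F' x - F' y) \<le> \<Lambda> * norm (x - y)" by blast
  show ?thesis
  proof (rule that[OF \<Lambda>(1)])
    fix x y v assume xy: "x \<in> cball c R" "y \<in> cball c R"
    have "norm (F' y v - F' x v) = norm ((F' y - F' x) v)" by (simp add: blinfun.diff_left)
    also have "\<dots> \<le> norm (F' y - F' x) * norm v" by (rule norm_blinfun)
    also have "\<dots> \<le> \<Lambda> * norm (y - x) * norm v" using \<Lambda>(2)[OF xy(2,1)] by (intro mult_right_mono) auto
    finally show "norm (jacobian F (at y) *v v - jacobian F (at x) *v v) \<le> \<Lambda> * norm (y - x) * norm v"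
      by (simp add: jac)
  next
    fix x y assume xy: "x \<in> cball c R" "y \<in> cball c R"
    have seg: "closed_segment x y \<subseteq> cball c R" using xy by (intro closed_segment_subset convex_cball)
    have "norm (F y - F x - F' x (y - x)) \<le> norm (y - x) * (\<Lambda> * norm (y - x))"
    proof (rule differentiable_bound_linearization[where S = "closed_segment x y" and f' = "\<lambda>z. blinfun_apply (F' z)"])
      show "x + t *\<^sub>R (y - x) \<in> closed_segment x y" if "t \<in> {0..1}" for t
        using that by (auto simp: closed_segment_def algebra_simps intro!: exI[of _ t])
      show "(F has_derivative blinfun_apply (F' z)) (at z within closed_segment x y)" for z
        using F' by (rule has_derivative_at_withinI)
      show "onorm (blinfun_apply (F' z) - blinfun_apply (F' x)) \<le> \<Lambda> * norm (y - x)"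
        if z: "z \<in> closed_segment x y" for z
      proof -
        have "onorm (blinfun_apply (F' z) - blinfun_apply (F' x)) = norm (F' z - F' x)"
          by (simp add: norm_blinfun.rep_eq minus_blinfun.rep_eq fun_diff_def)
        also have "\<dots> \<le> \<Lambda> * norm (z - x)" using \<Lambda>(2) seg z xy by blast
        also have "norm (z - x) \<le> norm (y - x)" using segment_bound1[OF z] by simp
        finally show ?thesis using \<Lambda>(1) by (simp add: mult_left_mono)
      qed
    qed simp
    then show "norm (F y - lin x y) \<le> \<Lambda> * (norm (y - x))\<^sup>2"
      by (simp add: jac power2_eq_square diff_diff_eq mult_ac)
  qed
qed

lemma continuous_on_F: "continuous_on X F"
proof -
  obtain F' :: "real^'n \<Rightarrow> (real^'n) \<Rightarrow>\<^sub>L (real^'m)"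
    where F': "\<And>x. (F has_derivative blinfun_apply (F' x)) (at x)" by (rule derivative_blinfun) (rule that; blast)
  then show ?thesis by (meson continuous_at_imp_continuous_on has_derivative_continuous)
qed

lemma continuous_on_g: "continuous_on X g"
  using convex_on_continuous[OF open_UNIV g_convex] by (rule continuous_on_subset) simp

lemma continuous_on_lin:
  assumes a: "continuous_on X a" and b: "continuous_on X b"
  shows "continuous_on X (\<lambda>z. lin (a z) (b z))"
proof -
  obtain F' :: "real^'n \<Rightarrow> (real^'n) \<Rightarrow>\<^sub>L (real^'m)"
    where jac: "\<And>x v. jacobian F (at x) *v v = F' x v" and cont: "continuous_on UNIV F'"
    by (rule derivative_blinfun) (rule that; blast)
  have "continuous_on X (\<lambda>z. F' (a z))"
    by (rule continuous_on_compose2[OF cont a]) simp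
  moreover have "continuous_on X (\<lambda>z. F (a z))"
    by (rule continuous_on_compose2[OF continuous_on_F[of UNIV] a]) simp
  ultimately show ?thesis unfolding jac using a b by (intro continuous_intros)
qed

lemma continuous_on_model:
  assumes "continuous_on X a" "continuous_on X m" "continuous_on X b"
  shows "continuous_on X (\<lambda>z. model (a z) (m z) (b z))"
proof -
  have "continuous_on X (\<lambda>z. g (lin (a z) (b z)))"
    by (rule continuous_on_compose2[OF continuous_on_g[of UNIV] continuous_on_lin[OF assms(1,3)]]) simp
  then show ?thesis unfolding gn_model_def using assms by (intro continuous_intros) auto
qed

text \<open>By convexity, a decrease of the linearized objective at a distance of at least 1 from \<open>x\<close> is at most the
  decrease at distance 1 in the same direction, scaled up linearly; the latter is bounded by compactness.\<close>

lemma linear_model_lower_bound: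
  obtains B where "B \<ge> 0"
    and "\<And>x y. x \<in> cball c R \<Longrightarrow> norm (y - x) \<ge> 1 \<Longrightarrow> g (lin x y) \<ge> g (F x) - B * norm (y - x)"
proof -
  let ?K = "cball c R \<times> cball (0 :: real^'n) 1"
  let ?\<phi> = "\<lambda>w. g (lin (fst w) (fst w + snd w)) - g (F (fst w))"
  have "continuous_on ?K (\<lambda>w. g (F (fst w)))"
    by (rule continuous_on_compose2[OF continuous_on_g[of UNIV] continuous_on_compose2[OF continuous_on_F[of UNIV]]])
      (auto intro!: continuous_intros)
  moreover have "continuous_on ?K (\<lambda>w. g (lin (fst w) (fst w + snd w)))"
    by (rule continuous_on_compose2[OF continuous_on_g[of UNIV] continuous_on_lin])
      (auto intro!: continuous_intros)
  ultimately have "continuous_on ?K ?\<phi>" by (intro continuous_intros)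
  from continuous_on_compact_bound[OF compact_Times[OF compact_cball compact_cball] this]
  obtain B where B: "\<forall>w\<in>?K. norm (?\<phi> w) \<le> B" by blast
  show ?thesis
  proof (rule that[of "max 0 B"])
    fix x y assume x: "x \<in> cball c R" and y: "norm (y - x) \<ge> 1"
    define d where "d = norm (y - x)"
    define u where "u = (1 / d) *\<^sub>R (y - x)"
    have d: "d \<ge> 1" using y by (simp add: d_def)
    have "norm u = 1" using d by (auto simp: u_def d_def)
    then have \<phi>: "g (lin x (x + u)) - g (F x) \<ge> - B" using B[rule_format, of "(x, u)"] x by auto
    have "lin x (x + u) = (1 - 1 / d) *\<^sub>R F x + (1 / d) *\<^sub>R lin x y"
      using d by (simp add: u_def matrix_vector_mult_scaleR algebra_simps)
    then have "g (lin x (x + u)) \<le> (1 - 1 / d) * g (F x) + (1 / d) * g (lin x y)"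
      using convex_onD[OF g_convex, of "1 / d" "F x" "lin x y"] d by simp
    then have "- B \<le> (1 / d) * (g (lin x y) - g (F x))" using \<phi> by (simp add: algebra_simps)
    then have "- B * d \<le> g (lin x y) - g (F x)" using d by (simp add: field_simps)
    moreover have "B * d \<le> max 0 B * d" using d by (intro mult_right_mono) auto
    ultimately show "g (lin x y) \<ge> g (F x) - max 0 B * norm (y - x)" by (simp add: d_def)
  qed simp
qed

text \<open>The linearized objective decreases at most linearly at infinity, which the quadratic term dominates.\<close>

lemma ex_model_minimizer:
  assumes x: "x \<in> D" and \<mu>: "\<mu> > 0"
  shows "\<exists>y. model_minimizer x \<mu> y"
proof -
  obtain B where B: "B \<ge> 0"
    "\<And>x' y. x' \<in> cball x 0 \<Longrightarrow> norm (y - x') \<ge> 1 \<Longrightarrow> g (lin x' y) \<ge> g (F x') - B * norm (y - x')"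
    by (rule linear_model_lower_bound[of x 0]) (rule that; blast)
  define K where "K = {y \<in> D. model x \<mu> y \<le> model x \<mu> x}"
  have cont: "continuous_on X (model x \<mu>)" for X
    by (intro continuous_on_model continuous_intros)
  have "K = D \<inter> {y. model x \<mu> y \<le> model x \<mu> x}" by (auto simp: K_def)
  then have "closed K" using D_closed cont
    by (simp add: closed_Int closed_Collect_le)
  moreover have "K \<subseteq> cball x (max 1 (2 * B / \<mu>))"
  proof
    fix y assume "y \<in> K"
    then have le: "g (lin x y) + \<mu> / 2 * (norm (y - x))\<^sup>2 \<le> g (F x)"
      by (simp add: K_def model_self) (simp add: gn_model_def)
    have "norm (y - x) \<le> 2 * B / \<mu>" if "norm (y - x) \<ge> 1"
    proof -
      have "\<mu> / 2 * (norm (y - x))\<^sup>2 \<le> B * norm (y - x)" using le B(2)[OF _ that] by simp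
      then have "\<mu> / 2 * norm (y - x) \<le> B" using that by (rule cancel_norm_factor)
      then show ?thesis using \<mu> by (simp add: field_simps)
    qed
    then have "norm (y - x) \<le> max 1 (2 * B / \<mu>)" by (cases "norm (y - x) \<ge> 1") auto
    then show "y \<in> cball x (max 1 (2 * B / \<mu>))" by (simp add: dist_norm norm_minus_commute)
  qed
  ultimately have compact: "compact K"
    using bounded_subset[OF bounded_cball] by (simp add: compact_eq_bounded_closed)
  have "K \<noteq> {}" using x by (auto simp: K_def)
  from continuous_attains_inf[OF compact this cont]
  obtain y where y: "y \<in> K" "\<forall>y'\<in>K. model x \<mu> y \<le> model x \<mu> y'" by (elim bexE) (rule that)
  have "model x \<mu> y \<le> model x \<mu> y'" if "y' \<in> D" for y'
    using y that unfolding K_def by (cases "model x \<mu> y' \<le> model x \<mu> x") auto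
  then show ?thesis using y(1) unfolding model_minimizer_def K_def by blast
qed

lemma gn_candidate_minimizer:
  assumes "x \<in> D" "\<mu> > 0"
  shows "model_minimizer x \<mu> (gn_candidate F g D x \<mu>)"
proof -
  obtain y where y: "y \<in> D" "\<And>y'. y' \<in> D \<Longrightarrow> model x \<mu> y \<le> model x \<mu> y'"
    using ex_model_minimizer[OF assms] unfolding model_minimizer_def by blast
  show ?thesis unfolding gn_candidate_def
    by (rule arg_minI[where P = "\<lambda>y. y \<in> D" and x = y]) (use y in \<open>auto simp: model_minimizer_def not_less\<close>)
qed

text \<open>Compare the minimizer with the midpoint between it and \<open>x\<close>, where the quadratic term is four times
  smaller. (The optimal constant is \<open>\<mu>\<close> divided by 2.)\<close>

lemma model_minimizer_decrease:
  assumes x: "x \<in> D" and y: "model_minimizer x \<mu> y"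
  shows "model x \<mu> y \<le> g (F x) - \<mu> / 4 * (norm (y - x))\<^sup>2"
proof -
  define p where "p = (1 / 2) *\<^sub>R x + (1 / 2) *\<^sub>R y"
  have "p \<in> D" using x y D_convex unfolding p_def model_minimizer_def by (intro convexD) auto
  then have "model x \<mu> y \<le> model x \<mu> p" using y by (simp add: model_minimizer_def)
  have px: "p - x = (1 / 2) *\<^sub>R (y - x)" by (simp add: p_def vec_eq_iff field_simps)
  have "lin x p = (1 - 1 / 2) *\<^sub>R F x + (1 / 2) *\<^sub>R lin x y"
    unfolding px matrix_vector_mult_scaleR by (simp add: vec_eq_iff field_simps)
  then have "g (lin x p) \<le> (1 - 1 / 2) * g (F x) + (1 / 2) * g (lin x y)"
    using convex_onD[OF g_convex, of "1 / 2" "F x" "lin x y"] by simp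
  moreover have "g (lin x y) + \<mu> / 2 * (norm (y - x))\<^sup>2 \<le> g (lin x p) + \<mu> / 2 * ((norm (y - x))\<^sup>2 / 4)"
  proof -
    have "(norm (p - x))\<^sup>2 = (norm (y - x))\<^sup>2 / 4" unfolding px by (simp add: power_divide)
    then show ?thesis using \<open>model x \<mu> y \<le> model x \<mu> p\<close> by (simp only: gn_model_def)
  qed
  moreover define q where "q = \<mu> * (norm (y - x))\<^sup>2"
  ultimately have "g (lin x y) + q / 2 \<le> g (F x) - q / 4" by simp
  then have "g (lin x y) + \<mu> / 2 * (norm (y - x))\<^sup>2 \<le> g (F x) - \<mu> / 4 * (norm (y - x))\<^sup>2"
    by (simp add: q_def)
  then show ?thesis by (simp only: gn_model_def)
qed

lemma Lipschitz_on_linearizations: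
  obtains L where "L \<ge> 0"
    and "\<And>x y x' y'. x \<in> cball c R \<Longrightarrow> y \<in> cball c R \<Longrightarrow> x' \<in> cball c R \<Longrightarrow> y' \<in> cball c R \<Longrightarrow>
      g (lin x' y') - g (lin x y) \<le> L * norm (lin x' y' - lin x y)"
proof -
  let ?K = "cball c R \<times> cball c R"
  have "continuous_on ?K (\<lambda>w. lin (fst w) (snd w))"
    by (intro continuous_on_lin continuous_intros)
  from continuous_on_compact_bound[OF compact_Times[OF compact_cball compact_cball] this]
  obtain r where "\<forall>w\<in>?K. norm (lin (fst w) (snd w)) \<le> r" by blast
  then have r: "norm (lin x y) \<le> r" if "x \<in> cball c R" "y \<in> cball c R" for x y
    using that by (metis SigmaI fst_conv snd_conv)
  obtain L where L: "L \<ge> 0" "\<And>u v. u \<in> cball 0 r \<Longrightarrow> v \<in> cball 0 r \<Longrightarrow> g v - g u \<le> L * norm (v - u)"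
    using convex_on_UNIV_Lipschitz_on_ball[OF g_convex, of r] by blast
  show ?thesis
    by (rule that[OF L(1)], rule L(2)) (use r in simp_all)
qed

text \<open>A large parameter forces the minimizer into the unit ball around \<open>x\<close>, where the quadratic Taylor
  remainder of \<open>F\<close>, times a Lipschitz constant of \<open>g\<close>, is dominated by the quadratic term of
  the model.\<close>

lemma model_majorizes:
  obtains M where "M \<ge> 0"
    and "\<And>x \<mu> y. x \<in> D \<inter> cball c R \<Longrightarrow> \<mu> \<ge> M \<Longrightarrow> model_minimizer x \<mu> y \<Longrightarrow> g (F y) \<le> model x \<mu> y"
proof -
  obtain B where B: "B \<ge> 0"
    "\<And>x y. x \<in> cball c R \<Longrightarrow> norm (y - x) \<ge> 1 \<Longrightarrow> g (lin x y) \<ge> g (F x) - B * norm (y - x)"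
    by (rule linear_model_lower_bound[of c R]) (rule that; blast)
  obtain \<Lambda> where \<Lambda>: "\<Lambda> \<ge> 0"
    "\<And>x y. x \<in> cball c (R + 1) \<Longrightarrow> y \<in> cball c (R + 1) \<Longrightarrow> norm (F y - lin x y) \<le> \<Lambda> * (norm (y - x))\<^sup>2"
    by (rule Taylor_bounds[of c "R + 1"]) (rule that; blast)
  obtain L where L: "L \<ge> 0"
    "\<And>x y x' y'. x \<in> cball c (R + 1) \<Longrightarrow> y \<in> cball c (R + 1) \<Longrightarrow> x' \<in> cball c (R + 1) \<Longrightarrow> y' \<in> cball c (R + 1) \<Longrightarrow>
      g (lin x' y') - g (lin x y) \<le> L * norm (lin x' y' - lin x y)"
    by (rule Lipschitz_on_linearizations[of c "R + 1"]) (rule that; blast)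
  show ?thesis
  proof (rule that[of "2 * B + 2 * (L * \<Lambda>) + 1"])
    show "2 * B + 2 * (L * \<Lambda>) + 1 \<ge> 0" using B(1) L(1) \<Lambda>(1) by simp
  next
    fix x \<mu> y assume x: "x \<in> D \<inter> cball c R" and \<mu>: "\<mu> \<ge> 2 * B + 2 * (L * \<Lambda>) + 1"
      and y: "model_minimizer x \<mu> y"
    have LL: "0 \<le> L * \<Lambda>" using L(1) \<Lambda>(1) by simp
    have "model x \<mu> y \<le> model x \<mu> x" using x y by (simp add: model_minimizer_def)
    then have le: "g (lin x y) + \<mu> / 2 * (norm (y - x))\<^sup>2 \<le> g (F x)"
      by (simp add: model_self) (simp add: gn_model_def)
    have "norm (y - x) < 1"
    proof (rule ccontr)
      assume "\<not> norm (y - x) < 1"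
      then have far: "norm (y - x) \<ge> 1" by simp
      then have "\<mu> / 2 * (norm (y - x))\<^sup>2 \<le> B * norm (y - x)" using le B(2)[of x y] x by simp
      then have "\<mu> / 2 * norm (y - x) \<le> B" using far by (rule cancel_norm_factor)
      moreover have "\<mu> / 2 * 1 \<le> \<mu> / 2 * norm (y - x)"
        using far \<mu> B(1) LL by (intro mult_left_mono) auto
      ultimately show False using \<mu> LL by simp
    qed
    then have y': "y \<in> cball c (R + 1)"
      using x dist_triangle[of c y x] by (simp add: dist_norm norm_minus_commute)
    have x': "x \<in> cball c (R + 1)" using x by simp
    have "g (F y) - g (lin x y) \<le> L * norm (F y - lin x y)"
      using L(2)[OF x' y' y' y'] by simp
    also have "\<dots> \<le> L * (\<Lambda> * (norm (y - x))\<^sup>2)" using \<Lambda>(2)[OF x' y'] L(1) by (rule mult_left_mono)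
    also have "\<dots> = L * \<Lambda> * (norm (y - x))\<^sup>2" by simp
    also have "\<dots> \<le> \<mu> / 2 * (norm (y - x))\<^sup>2" using \<mu> B(1) by (intro mult_right_mono) auto
    finally show "g (F y) \<le> model x \<mu> y" by (simp add: gn_model_def)
  qed
qed

text \<open>Every parameter from a threshold \<open>M\<close> on is accepted, uniformly on a bounded set, so the loop stops at the
  latest at its first parameter above \<open>M\<close>, which is at most \<open>\<tau> M\<close> unless it is
  \<open>\<mu>\<^sub>0\<close>. The termination measure uses that each pass adds at least
  \<open>(\<tau> - 1) \<mu>\<^sub>0\<close>.\<close>

lemma gn_parameter_bounds:
  assumes "\<mu>\<^sub>0 > 0" "\<tau> > 1"
  obtains M where "M \<ge> \<mu>\<^sub>0"
    and "\<And>x. x \<in> D \<inter> cball c R \<Longrightarrow> \<mu>\<^sub>0 \<le> gn_parameter F g D \<mu>\<^sub>0 \<tau> x \<and> gn_parameter F g D \<mu>\<^sub>0 \<tau> x \<le> M \<and>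
      g (F (gn_candidate F g D x (gn_parameter F g D \<mu>\<^sub>0 \<tau> x)))
        \<le> model x (gn_parameter F g D \<mu>\<^sub>0 \<tau> x) (gn_candidate F g D x (gn_parameter F g D \<mu>\<^sub>0 \<tau> x))"
proof -
  obtain M where M: "M \<ge> 0"
    "\<And>x \<mu> y. x \<in> D \<inter> cball c R \<Longrightarrow> \<mu> \<ge> M \<Longrightarrow> model_minimizer x \<mu> y \<Longrightarrow> g (F y) \<le> model x \<mu> y"
    by (rule model_majorizes[of c R]) (rule that; blast)
  show ?thesis
  proof (rule that[of "max \<mu>\<^sub>0 (\<tau> * M)"])
    fix x assume x: "x \<in> D \<inter> cball c R"
    let ?test = "\<lambda>\<mu>. g (F (gn_candidate F g D x \<mu>)) > model x \<mu> (gn_candidate F g D x \<mu>)"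
    let ?P = "\<lambda>\<mu>. \<mu>\<^sub>0 \<le> \<mu> \<and> \<mu> \<le> max \<mu>\<^sub>0 (\<tau> * M)"
    define \<delta> where "\<delta> = (\<tau> - 1) * \<mu>\<^sub>0"
    have \<delta>: "\<delta> > 0" using assms by (simp add: \<delta>_def)
    have small: "\<mu> < M" if "?P \<mu>" "?test \<mu>" for \<mu>
    proof (rule ccontr)
      assume "\<not> \<mu> < M"
      then have "g (F (gn_candidate F g D x \<mu>)) \<le> model x \<mu> (gn_candidate F g D x \<mu>)"
        using x that assms by (intro M(2) gn_candidate_minimizer) auto
      with that show False by simp
    qed
    have "?P (while ?test (\<lambda>\<mu>. \<tau> * \<mu>) \<mu>\<^sub>0) \<and> \<not> ?test (while ?test (\<lambda>\<mu>. \<tau> * \<mu>) \<mu>\<^sub>0)"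
    proof (rule while_rule[where P = ?P and r = "Wellfounded.measure (\<lambda>\<mu>. nat \<lceil>(M - \<mu>) / \<delta>\<rceil>)"])
      fix \<mu> assume \<mu>: "?P \<mu>" "?test \<mu>"
      have step: "\<mu> + \<delta> \<le> \<tau> * \<mu>"
        using mult_left_mono[of \<mu>\<^sub>0 \<mu> "\<tau> - 1"] \<mu>(1) assms by (simp add: \<delta>_def algebra_simps)
      moreover have "\<tau> * \<mu> \<le> \<tau> * M" using small[OF \<mu>] assms by simp
      ultimately show "?P (\<tau> * \<mu>)" using \<mu>(1) \<delta> by (simp add: le_max_iff_disj)
      have "(M - \<tau> * \<mu>) / \<delta> \<le> (M - \<mu>) / \<delta> - 1"
        using divide_right_mono[of "M - \<tau> * \<mu>" "M - \<mu> - \<delta>" \<delta>] step \<delta>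
        by (simp add: diff_divide_distrib)
      moreover have "0 < (M - \<mu>) / \<delta>" using small[OF \<mu>] \<delta> by simp
      ultimately show "(\<tau> * \<mu>, \<mu>) \<in> Wellfounded.measure (\<lambda>\<mu>. nat \<lceil>(M - \<mu>) / \<delta>\<rceil>)"
        by simp linarith
    qed auto
    then show "\<mu>\<^sub>0 \<le> gn_parameter F g D \<mu>\<^sub>0 \<tau> x \<and> gn_parameter F g D \<mu>\<^sub>0 \<tau> x \<le> max \<mu>\<^sub>0 (\<tau> * M) \<and>
      g (F (gn_candidate F g D x (gn_parameter F g D \<mu>\<^sub>0 \<tau> x)))
        \<le> model x (gn_parameter F g D \<mu>\<^sub>0 \<tau> x) (gn_candidate F g D x (gn_parameter F g D \<mu>\<^sub>0 \<tau> x))"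
      unfolding gn_parameter_def by simp
  qed simp
qed

lemma definable_model:
  assumes "o_minimal_structure S" "definable_fun S F" "definable_fun S g"
  shows "o_minimal_structure.definable_map S (\<lambda>z. model (fst z) (fst (snd z)) (snd (snd z)))"
proof -
  interpret o_minimal_structure S by fact
  have F: "definable_map F" and g: "definable_map g"
    using assms by (simp_all add: definable_map_definable_fun)
  obtain F' :: "real^'n \<Rightarrow> (real^'n) \<Rightarrow>\<^sub>L (real^'m)"
    where F': "\<And>x. (F has_derivative blinfun_apply (F' x)) (at x)"
      and jac: "\<And>x v. jacobian F (at x) *v v = F' x v"
    by (rule derivative_blinfun) (rule that; blast)
  have jac_map: "definable_map (\<lambda>w. F' (fst w) (snd w))"
    by (rule definable_map_derivative[OF F F'])
  have "definable_map (\<lambda>z :: (real^'n) \<times> real \<times> (real^'n). g (F (fst z) + F' (fst z) (snd (snd z) - fst z)) +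
      (1 / 2) * fst (snd z) * (norm (snd (snd z) - fst z) * norm (snd (snd z) - fst z)))"
    by (intro definable_intros definable_map_norm definable_map_compose[OF F] definable_map_compose[OF g]
        definable_map_binary[OF jac_map])
  then show ?thesis by (simp add: gn_model_def jac power2_eq_square)
qed

text \<open>Test the minimality of \<open>y'\<close> with the point \<open>y\<close> and compare the two models there. Their
  linearizations differ by a Taylor remainder between \<open>x\<close> and \<open>x'\<close> and by a difference of
  Jacobians applied to \<open>y - x'\<close>; neither involves a term that is linear in \<open>e\<close> alone. The
  same holds for the difference of the quadratic terms, since the parameters and the distance of \<open>x\<close> and
  \<open>y\<close> are bounded.\<close>

lemma model_slope:
  assumes M: "M \<ge> 0"
  obtains C where "C \<ge> 0"
    and "\<And>x \<mu> y x' \<mu>' y' e. x \<in> cball c 1 \<Longrightarrow> x' \<in> cball c 1 \<Longrightarrow> y \<in> D \<inter> cball c 2 \<Longrightarrow> 0 \<le> \<mu> \<Longrightarrow>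
      0 \<le> \<mu>' \<Longrightarrow> \<mu>' \<le> M \<Longrightarrow> model_minimizer x' \<mu>' y' \<Longrightarrow> norm (x' - x) \<le> e \<Longrightarrow> \<bar>\<mu>' - \<mu>\<bar> \<le> e \<Longrightarrow>
      model x' \<mu>' y' - model x \<mu> y \<le> C * (norm (y - x) * e + e\<^sup>2)"
proof -
  obtain \<Lambda> where \<Lambda>: "\<Lambda> \<ge> 0"
    "\<And>x y v. x \<in> cball c 2 \<Longrightarrow> y \<in> cball c 2 \<Longrightarrow>
      norm (jacobian F (at y) *v v - jacobian F (at x) *v v) \<le> \<Lambda> * norm (y - x) * norm v"
    "\<And>x y. x \<in> cball c 2 \<Longrightarrow> y \<in> cball c 2 \<Longrightarrow> norm (F y - lin x y) \<le> \<Lambda> * (norm (y - x))\<^sup>2"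
    by (rule Taylor_bounds[of c 2]) (rule that; blast)
  obtain L where L: "L \<ge> 0"
    "\<And>x y x' y'. x \<in> cball c 2 \<Longrightarrow> y \<in> cball c 2 \<Longrightarrow> x' \<in> cball c 2 \<Longrightarrow> y' \<in> cball c 2 \<Longrightarrow>
      g (lin x' y') - g (lin x y) \<le> L * norm (lin x' y' - lin x y)"
    by (rule Lipschitz_on_linearizations[of c 2]) (rule that; blast)
  show ?thesis
  proof (rule that[of "2 * (L * \<Lambda>) + M + 2"])
    have LL: "L * \<Lambda> \<ge> 0" using L \<Lambda> by simp
    then show "2 * (L * \<Lambda>) + M + 2 \<ge> 0" using M by simp
    fix x \<mu> y x' \<mu>' y' e
    assume x: "x \<in> cball c 1" "x' \<in> cball c 1" and y: "y \<in> D \<inter> cball c 2"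
      and \<mu>: "0 \<le> \<mu>" "0 \<le> \<mu>'" "\<mu>' \<le> M" and y': "model_minimizer x' \<mu>' y'"
      and e: "norm (x' - x) \<le> e" "\<bar>\<mu>' - \<mu>\<bar> \<le> e"
    define \<sigma> where "\<sigma> = norm (y - x)"
    have \<sigma>0: "\<sigma> \<ge> 0" and e0: "e \<ge> 0" using e norm_ge_zero[of "x' - x"] by (simp_all add: \<sigma>_def)
    have x2: "x \<in> cball c 2" "x' \<in> cball c 2" "y \<in> cball c 2" using x y by auto
    \<comment> \<open>The points \<open>x\<close> and \<open>y\<close> lie in balls of radius 1 and 2 around \<open>c\<close>; this
      bounds \<open>\<sigma>\<^sup>2\<close> by a multiple of \<open>\<sigma>\<close>.\<close>
    have \<sigma>3: "\<sigma> \<le> 3"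
      using x y norm_triangle_ineq4[of "y - c" "x - c"] by (simp add: \<sigma>_def dist_norm norm_minus_commute)
    have \<sigma>': "norm (y - x') \<le> \<sigma> + e"
      using e(1) norm_triangle_ineq[of "y - x" "x - x'"] by (simp add: \<sigma>_def norm_minus_commute)
    have split: "lin x' y - lin x y = (F x' - lin x x') + (jacobian F (at x') *v (y - x') - jacobian F (at x) *v (y - x'))"
      by (simp add: matrix_vector_mult_diff_distrib)
    have "norm (lin x' y - lin x y) \<le> \<Lambda> * (norm (x' - x))\<^sup>2 + \<Lambda> * norm (x' - x) * norm (y - x')"
      unfolding split
      by (rule order_trans[OF norm_triangle_ineq add_mono[OF \<Lambda>(3)[OF x2(1,2)] \<Lambda>(2)[OF x2(1,2)]]])
    also have "\<dots> \<le> \<Lambda> * e\<^sup>2 + \<Lambda> * e * (\<sigma> + e)"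
      using e(1) \<sigma>' \<Lambda>(1) \<sigma>0 e0 by (intro add_mono mult_left_mono mult_mono power_mono) auto
    finally have lin: "norm (lin x' y - lin x y) \<le> 2 * \<Lambda> * (\<sigma> * e + e\<^sup>2)"
    proof (rule order_trans)
      have "0 \<le> \<Lambda> * (\<sigma> * e)" using \<Lambda>(1) \<sigma>0 e0 by simp
      then show "\<Lambda> * e\<^sup>2 + \<Lambda> * e * (\<sigma> + e) \<le> 2 * \<Lambda> * (\<sigma> * e + e\<^sup>2)"
        by (simp add: power2_eq_square algebra_simps)
    qed
    have "g (lin x' y) - g (lin x y) \<le> L * norm (lin x' y - lin x y)" by (rule L(2)[OF x2(1,3,2,3)])
    also have "\<dots> \<le> L * (2 * \<Lambda> * (\<sigma> * e + e\<^sup>2))" using lin L(1) by (rule mult_left_mono)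
    finally have g_part: "g (lin x' y) - g (lin x y) \<le> 2 * (L * \<Lambda>) * (\<sigma> * e + e\<^sup>2)" by (simp add: mult_ac)
    have "\<mu>' / 2 * (norm (y - x'))\<^sup>2 \<le> \<mu>' / 2 * (\<sigma> + e)\<^sup>2"
      using \<sigma>' \<mu>(2) by (intro mult_left_mono power_mono) auto
    also have "\<dots> = \<mu>' / 2 * \<sigma>\<^sup>2 + \<mu>' * (\<sigma> * e + e\<^sup>2 / 2)"
      by (simp add: power2_sum algebra_simps)
    also have "\<mu>' * (\<sigma> * e + e\<^sup>2 / 2) \<le> M * (\<sigma> * e + e\<^sup>2)"
      using \<mu> M \<sigma>0 e0 by (intro mult_mono) auto
    also have "\<mu>' / 2 * \<sigma>\<^sup>2 \<le> \<mu> / 2 * \<sigma>\<^sup>2 + 2 * (\<sigma> * e + e\<^sup>2)"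
    proof -
      have "(\<mu>' - \<mu>) * (\<sigma> * \<sigma>) \<le> e * (3 * \<sigma>)"
        using e(2) \<sigma>0 \<sigma>3 e0 by (intro mult_mono) auto
      then have "\<mu>' / 2 * \<sigma>\<^sup>2 \<le> \<mu> / 2 * \<sigma>\<^sup>2 + 3 / 2 * (\<sigma> * e)"
        by (simp add: power2_eq_square algebra_simps)
      also have "3 / 2 * (\<sigma> * e) \<le> 2 * (\<sigma> * e + e\<^sup>2)"
      proof -
        have "3 / 2 * p \<le> 2 * (p + q)" if "p \<ge> 0" "q \<ge> 0" for p q :: real using that by simp
        then show ?thesis using \<sigma>0 e0 by simp
      qed
      finally show ?thesis by simp
    qed
    finally have "\<mu>' / 2 * (norm (y - x'))\<^sup>2 - \<mu> / 2 * \<sigma>\<^sup>2 \<le> (M + 2) * (\<sigma> * e + e\<^sup>2)"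
      by (simp add: algebra_simps)
    moreover have "model x' \<mu>' y' \<le> model x' \<mu>' y" using y y' by (simp add: model_minimizer_def)
    ultimately have "model x' \<mu>' y' - model x \<mu> y \<le> 2 * (L * \<Lambda>) * (\<sigma> * e + e\<^sup>2) + (M + 2) * (\<sigma> * e + e\<^sup>2)"
      using g_part unfolding gn_model_def \<sigma>_def by linarith
    then show "model x' \<mu>' y' - model x \<mu> y \<le> (2 * (L * \<Lambda>) + M + 2) * (norm (y - x) * e + e\<^sup>2)"
      by (simp add: \<sigma>_def algebra_simps)
  qed
qed

text \<open>The model differs from \<open>g \<circ> F\<close> near \<open>x\<close> only to second order. As \<open>x\<close>
  minimizes it, \<open>g \<circ> F\<close> drops at most quadratically around \<open>x\<close> within
  \<open>D\<close>, and 0 is already a Frechet subgradient at \<open>x\<close>.\<close>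

lemma critical_point_if_model_minimizer:
  assumes "model_minimizer x \<mu> x"
  shows "critical_point F g D x"
proof -
  have x: "x \<in> D" and min: "\<And>y. y \<in> D \<Longrightarrow> g (F x) \<le> model x \<mu> y"
    using assms by (auto simp: model_minimizer_def model_self)
  obtain \<Lambda> where \<Lambda>: "\<Lambda> \<ge> 0"
    "\<And>y z. y \<in> cball x 1 \<Longrightarrow> z \<in> cball x 1 \<Longrightarrow> norm (F z - lin y z) \<le> \<Lambda> * (norm (z - y))\<^sup>2"
    by (rule Taylor_bounds[of x 1]) (rule that; blast)
  obtain L where L: "L \<ge> 0"
    "\<And>y z y' z'. y \<in> cball x 1 \<Longrightarrow> z \<in> cball x 1 \<Longrightarrow> y' \<in> cball x 1 \<Longrightarrow> z' \<in> cball x 1 \<Longrightarrow>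
      g (lin y' z') - g (lin y z) \<le> L * norm (lin y' z' - lin y z)"
    by (rule Lipschitz_on_linearizations[of x 1]) (rule that; blast)
  define K where "K = L * \<Lambda> + \<mu> / 2"
  have lower: "g (F z) - g (F x) \<ge> - K * (norm (z - x))\<^sup>2" if z: "z \<in> D" "z \<in> cball x 1" for z
  proof -
    have "g (lin x z) - g (F z) \<le> L * norm (lin x z - F z)"
      using L(2)[of z z x z] z(2) by simp
    also have "\<dots> \<le> L * (\<Lambda> * (norm (z - x))\<^sup>2)"
      using \<Lambda>(2)[of x z] z(2) L(1) by (intro mult_left_mono) (auto simp: norm_minus_commute)
    finally show ?thesis using min[OF z(1)] by (simp add: gn_model_def K_def algebra_simps)
  qed
  define h where "h = (\<lambda>y. ereal (g (F y)) + indicator_inf D y)"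
  have hx: "h x = ereal (g (F x))" using x by (simp add: h_def indicator_inf_def)
  have "0 \<in> frechet_subdifferential h x"
    unfolding frechet_subdifferential_def
  proof (intro CollectI conjI)
    show "\<bar>h x\<bar> \<noteq> \<infinity>" by (simp add: hx)
    have "((\<lambda>z. - K * norm (z - x)) \<longlongrightarrow> - K * norm (x - x)) (at x)"
      by (intro tendsto_intros)
    then have "((\<lambda>z. ereal (- K * norm (z - x))) \<longlongrightarrow> 0) (at x)"
      by (simp add: zero_ereal_def)
    then have "0 = Liminf (at x) (\<lambda>z. ereal (- K * norm (z - x)))"
      by (intro lim_imp_Liminf[symmetric]) simp_all
    also have "\<dots> \<le> Liminf (at x) (\<lambda>y. (h y - h x - ereal (0 \<bullet> (y - x))) / ereal (norm (y - x)))"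
    proof (rule Liminf_mono)
      have "\<forall>\<^sub>F z in at x. z \<in> cball x 1 \<and> z \<noteq> x"
        unfolding eventually_at by (intro exI[of _ 1]) (auto simp: dist_commute)
      then show "\<forall>\<^sub>F z in at x. ereal (- K * norm (z - x)) \<le> (h z - h x - ereal (0 \<bullet> (z - x))) / ereal (norm (z - x))"
      proof (rule eventually_mono)
        fix z assume z: "z \<in> cball x 1 \<and> z \<noteq> x"
        then have n: "norm (z - x) > 0" by simp
        show "ereal (- K * norm (z - x)) \<le> (h z - h x - ereal (0 \<bullet> (z - x))) / ereal (norm (z - x))"
        proof (cases "z \<in> D")
          case True
          have "- K * norm (z - x) \<le> (g (F z) - g (F x)) / norm (z - x)"
            using lower[OF True] z n by (simp add: pos_le_divide_eq power2_eq_square mult_ac)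
          then show ?thesis using True n by (simp add: h_def hx indicator_inf_def x)
        next
          case False
          then show ?thesis using n by (simp add: h_def indicator_inf_def x)
        qed
      qed
    qed
    finally show "0 \<le> Liminf (at x) (\<lambda>y. (h y - h x - ereal (0 \<bullet> (y - x))) / ereal (norm (y - x)))" .
  qed
  then have "0 \<in> limiting_subdifferential h x"
    unfolding limiting_subdifferential_def
    by (intro CollectI conjI exI[of _ "\<lambda>_. x"] exI[of _ "\<lambda>_. 0"]) (simp_all add: hx)
  then show ?thesis using x by (simp add: critical_point_def h_def)
qed

section \<open>Convergence of the algorithm\<close>

text \<open>Minimality of \<open>y\<close> is a system of closed conditions on the triple \<open>(x, \<mu>, y)\<close>, one for
  each competitor. This is why \<open>y\<close> is kept as a component, instead of being treated as a function of
  \<open>(x, \<mu>)\<close>.\<close>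

lemma compact_model_minimizers:
  "compact {z. fst z \<in> D \<inter> cball c 1 \<and> \<mu>\<^sub>0 \<le> fst (snd z) \<and> fst (snd z) \<le> M \<and>
     snd (snd z) \<in> cball c 2 \<and> model_minimizer (fst z) (fst (snd z)) (snd (snd z))}" (is "compact ?A")
proof -
  let ?K = "cball c 1 \<times> {\<mu>\<^sub>0..M} \<times> cball c 2"
  let ?E = "\<lambda>y. {z. model (fst z) (fst (snd z)) (snd (snd z)) \<le> model (fst z) (fst (snd z)) y}"
  have "closed (?E y)" for y
    by (intro closed_Collect_le continuous_on_model continuous_intros)
  moreover have "closed (fst -` D :: ((real^'n) \<times> real \<times> (real^'n)) set)"
    by (intro closed_vimage D_closed continuous_intros)
  moreover have "closed ((\<lambda>z. snd (snd z)) -` D :: ((real^'n) \<times> real \<times> (real^'n)) set)"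
    by (intro closed_vimage D_closed continuous_intros)
  ultimately have "compact (?K \<inter> ((fst -` D \<inter> (\<lambda>z. snd (snd z)) -` D) \<inter> (\<Inter>y\<in>D. ?E y)))"
    by (intro compact_Int_closed compact_Times compact_cball compact_Icc closed_Int closed_INT) auto
  also have "?K \<inter> ((fst -` D \<inter> (\<lambda>z. snd (snd z)) -` D) \<inter> (\<Inter>y\<in>D. ?E y)) = ?A"
    by (auto simp: model_minimizer_def)
  finally show ?thesis .
qed

lemma definable_model_minimizers:
  assumes "o_minimal_structure S" "definable_fun S F" "definable_fun S g" "definable_set S D"
  shows "definable_set S {z. fst z \<in> D \<inter> cball c 1 \<and> \<mu>\<^sub>0 \<le> fst (snd z) \<and> fst (snd z) \<le> M \<and>
     snd (snd z) \<in> cball c 2 \<and> model_minimizer (fst z) (fst (snd z)) (snd (snd z))}"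
proof -
  interpret o_minimal_structure S by fact
  have D: "definable_pred (\<lambda>x. x \<in> D)" using assms(4) by (simp add: definable_pred_def)
  have model: "definable_map (\<lambda>u. model (a u) (m u) (b u))"
    if "definable_map a" "definable_map m" "definable_map b"
    for a b :: "'c::euclidean_space \<Rightarrow> real^'n" and m
    using definable_map_compose[OF definable_model[OF assms(1-3)]
        definable_map_Pair[OF that(1) definable_map_Pair[OF that(2,3)]]] by simp
  have "definable_pred (\<lambda>z. fst z \<in> D \<and> norm (fst z - c) \<le> 1 \<and> \<mu>\<^sub>0 \<le> fst (snd z) \<and> fst (snd z) \<le> M \<and>
     norm (snd (snd z) - c) \<le> 2 \<and> snd (snd z) \<in> D \<and>
     (\<forall>y. y \<in> D \<longrightarrow> model (fst z) (fst (snd z)) (snd (snd z)) \<le> model (fst z) (fst (snd z)) y))"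
    by (intro definable_intros definable_map_norm model definable_pred_vimage[OF _ D])
  then show ?thesis
    unfolding definable_pred_def
    by (rule arg_cong[where f = "definable_set S", THEN iffD1, rotated])
      (auto simp: model_minimizer_def dist_norm norm_minus_commute)
qed

lemma iteration:
  assumes \<mu>\<^sub>0: "\<mu>\<^sub>0 > 0" and \<tau>: "\<tau> > 1" and x\<^sub>0: "x\<^sub>0 \<in> D"
    and seq: "gauss_newton_sequences F g D \<mu>\<^sub>0 \<tau> x\<^sub>0 x \<mu>"
  shows "x k \<in> D" and "\<mu>\<^sub>0 \<le> \<mu> k" and "model_minimizer (x k) (\<mu> k) (x (Suc k))"
    and "g (F (x (Suc k))) \<le> model (x k) (\<mu> k) (x (Suc k))"
    and "\<exists>M\<ge>\<mu>\<^sub>0. \<forall>k. x k \<in> cball c R \<longrightarrow> \<mu> k \<le> M"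
proof -
  have \<mu>_eq: "\<mu> k = gn_parameter F g D \<mu>\<^sub>0 \<tau> (x k)" and x_eq: "x (Suc k) = gn_candidate F g D (x k) (\<mu> k)" for k
    using seq by (auto simp: gauss_newton_sequences_def)
  have param: "\<mu>\<^sub>0 \<le> \<mu> k \<and> g (F (x (Suc k))) \<le> model (x k) (\<mu> k) (x (Suc k))" if "x k \<in> D" for k
  proof -
    obtain M where "\<And>y. y \<in> D \<inter> cball (x k) 0 \<Longrightarrow> \<mu>\<^sub>0 \<le> gn_parameter F g D \<mu>\<^sub>0 \<tau> y \<and> gn_parameter F g D \<mu>\<^sub>0 \<tau> y \<le> M \<and>
      g (F (gn_candidate F g D y (gn_parameter F g D \<mu>\<^sub>0 \<tau> y)))
        \<le> model y (gn_parameter F g D \<mu>\<^sub>0 \<tau> y) (gn_candidate F g D y (gn_parameter F g D \<mu>\<^sub>0 \<tau> y))"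
      by (rule gn_parameter_bounds[OF \<mu>\<^sub>0 \<tau>, where c = "x k" and R = 0]) (rule that; blast)
    from this[of "x k"] show ?thesis using that unfolding x_eq \<mu>_eq by simp
  qed
  have min: "model_minimizer (x k) (\<mu> k) (x (Suc k))" if "x k \<in> D" for k
    using gn_candidate_minimizer[OF that, of "\<mu> k"] param[OF that] \<mu>\<^sub>0 unfolding x_eq by simp
  have x: "x k \<in> D" for k
  proof (induction k)
    case 0
    show ?case using seq x\<^sub>0 by (simp add: gauss_newton_sequences_def)
  next
    case (Suc k)
    then show ?case using min by (simp add: model_minimizer_def)
  qed
  show "x k \<in> D" "\<mu>\<^sub>0 \<le> \<mu> k" "model_minimizer (x k) (\<mu> k) (x (Suc k))"
    "g (F (x (Suc k))) \<le> model (x k) (\<mu> k) (x (Suc k))"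
    using x param min by blast+
  obtain M where M: "M \<ge> \<mu>\<^sub>0" "\<And>y. y \<in> D \<inter> cball c R \<Longrightarrow> \<mu>\<^sub>0 \<le> gn_parameter F g D \<mu>\<^sub>0 \<tau> y \<and> gn_parameter F g D \<mu>\<^sub>0 \<tau> y \<le> M \<and>
      g (F (gn_candidate F g D y (gn_parameter F g D \<mu>\<^sub>0 \<tau> y)))
        \<le> model y (gn_parameter F g D \<mu>\<^sub>0 \<tau> y) (gn_candidate F g D y (gn_parameter F g D \<mu>\<^sub>0 \<tau> y))"
    by (rule gn_parameter_bounds[OF \<mu>\<^sub>0 \<tau>, where c = c and R = R]) (rule that; blast)
  have "\<mu> k \<le> M" if "x k \<in> cball c R" for k
    using M(2)[of "x k"] x that unfolding \<mu>_eq[of k] by simp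
  then show "\<exists>M\<ge>\<mu>\<^sub>0. \<forall>k. x k \<in> cball c R \<longrightarrow> \<mu> k \<le> M" using M(1) by blast
qed

text \<open>The minima of the accepted models are interlaced with the objective values and decrease to its value at the cluster
  point. If they stay above this limit, desingularization of the value function near \<open>c\<close> turns their
  decrease into the hypothesis of \<open>finite_length_convergence\<close>; the alternative that the steps are bounded
  below contradicts that they tend to 0.\<close>

lemma convergence_to_cluster_point:
  assumes "o_minimal_structure S" "definable_fun S F" "definable_fun S g" "definable_set S D"
    and \<mu>\<^sub>0: "\<mu>\<^sub>0 > 0" and \<tau>: "\<tau> > 1" and x\<^sub>0: "x\<^sub>0 \<in> D"
    and seq: "gauss_newton_sequences F g D \<mu>\<^sub>0 \<tau> x\<^sub>0 x \<mu>"
    and cluster: "strict_mono r" "(x \<circ> r) \<longlonglongrightarrow> c"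
  shows "x \<longlonglongrightarrow> c \<and> critical_point F g D c \<and> summable (\<lambda>k. norm (x (Suc k) - x k)) \<and> bounded (range \<mu>)"
proof -
  interpret o_minimal_structure S by fact
  note it = iteration[OF \<mu>\<^sub>0 \<tau> x\<^sub>0 seq]
  define h where "h k = g (F (x k))" for k
  define v where "v k = model (x k) (\<mu> k) (x (Suc k))" for k
  define \<sigma> where "\<sigma> k = norm (x (Suc k) - x k)" for k
  have hv: "h (Suc k) \<le> v k" for k using it(4) by (simp add: h_def v_def)
  have vh: "v k \<le> h k - \<mu>\<^sub>0 / 4 * (\<sigma> k)\<^sup>2" for k
  proof -
    have "\<mu>\<^sub>0 / 4 * (\<sigma> k)\<^sup>2 \<le> \<mu> k / 4 * (\<sigma> k)\<^sup>2" using it(2)[of k] by (intro mult_right_mono) auto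
    then show ?thesis
      using model_minimizer_decrease[OF it(1,3), of k] by (simp add: h_def v_def \<sigma>_def)
  qed
  have vh': "v k \<le> h k" for k
  proof -
    have "0 \<le> \<mu>\<^sub>0 / 4 * (\<sigma> k)\<^sup>2" using \<mu>\<^sub>0 by simp
    then show ?thesis using vh[of k] by linarith
  qed
  have h_dec: "decseq h" by (rule decseq_SucI) (rule order_trans[OF hv vh'])
  have c: "c \<in> D" by (rule closed_sequentially[OF D_closed _ cluster(2)]) (simp add: it(1))
  have gF: "isCont (\<lambda>y. g (F y)) c"
    using continuous_on_compose2[OF continuous_on_g[of UNIV] continuous_on_F[of UNIV]]
    by (simp add: continuous_on_eq_continuous_at)
  define w where "w = g (F c)"
  have h_sub: "(h \<circ> r) \<longlonglongrightarrow> w"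
    using isCont_tendsto_compose[OF gF cluster(2)] by (simp add: h_def w_def o_def)
  have h_ge: "w \<le> h k" for k
  proof (rule LIMSEQ_le_const2[OF h_sub], intro exI allI impI)
    fix n assume "k \<le> n"
    then have "k \<le> r n" using seq_suble[OF cluster(1), of n] by simp
    then show "(h \<circ> r) n \<le> h k" using h_dec by (simp add: decseq_def)
  qed
  obtain l where l: "h \<longlonglongrightarrow> l" using decseq_convergent[OF h_dec, of w] h_ge by blast
  then have "(h \<circ> r) \<longlonglongrightarrow> l" by (rule LIMSEQ_subseq_LIMSEQ[OF _ cluster(1)])
  then have h_lim: "h \<longlonglongrightarrow> w" using h_sub l LIMSEQ_unique by blast
  then have h_lim': "(\<lambda>k. h (Suc k)) \<longlonglongrightarrow> w" by (rule LIMSEQ_Suc)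
  have v_lim: "v \<longlonglongrightarrow> w"
    using tendsto_sandwich[OF always_eventually always_eventually h_lim' h_lim, of v] hv vh' by simp
  have \<sigma>_sq: "(\<sigma> k)\<^sup>2 \<le> 4 / \<mu>\<^sub>0 * (h k - v k)" for k
    using vh[of k] \<mu>\<^sub>0 by (simp add: field_simps)
  have "(\<lambda>k. 4 / \<mu>\<^sub>0 * (h k - v k)) \<longlonglongrightarrow> 4 / \<mu>\<^sub>0 * (w - w)"
    by (intro tendsto_intros h_lim v_lim)
  then have gap: "(\<lambda>k. 4 / \<mu>\<^sub>0 * (h k - v k)) \<longlonglongrightarrow> 0" by simp
  have "(\<lambda>k. (\<sigma> k)\<^sup>2) \<longlonglongrightarrow> 0"
    by (rule tendsto_sandwich[OF always_eventually always_eventually tendsto_const gap])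
      (simp_all only: \<sigma>_sq zero_le_power2 simp_thms)
  then have "(\<lambda>k. sqrt ((\<sigma> k)\<^sup>2)) \<longlonglongrightarrow> sqrt 0" by (rule tendsto_real_sqrt)
  then have \<sigma>_lim: "\<sigma> \<longlonglongrightarrow> 0" by (simp add: \<sigma>_def[abs_def])
  have v_dec: "v (Suc k) \<le> v k" for k using vh'[of "Suc k"] hv[of k] by linarith
  have v_ge: "w \<le> v k" for k using h_ge[of "Suc k"] hv[of k] by linarith
  obtain M where M: "M \<ge> \<mu>\<^sub>0" "\<And>k. x k \<in> cball c 1 \<Longrightarrow> \<mu> k \<le> M"
    using it(5)[of c 1] by blast

  have finite_length: "x \<longlonglongrightarrow> c \<and> summable \<sigma>"
  \<comment> \<open>If the limit value is attained, the sequence is stationary from then on.\<close>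
  proof (cases "\<exists>k. v k \<le> w")
    case True
    then obtain k\<^sub>1 where k\<^sub>1: "v k\<^sub>1 \<le> w" by blast
    have \<sigma>0: "(\<sigma> (Suc k))\<^sup>2 \<le> 0" if "k \<ge> k\<^sub>1" for k
    proof -
      have "h (Suc k) \<le> h (Suc k\<^sub>1)" using h_dec that by (simp add: decseq_def)
      then have "4 / \<mu>\<^sub>0 * (h (Suc k) - v (Suc k)) \<le> 4 / \<mu>\<^sub>0 * 0"
        using hv[of k\<^sub>1] k\<^sub>1 v_ge[of "Suc k"] \<mu>\<^sub>0 by (intro mult_left_mono) auto
      then show ?thesis using \<sigma>_sq[of "Suc k"] by linarith
    qed
    show ?thesis
      using finite_length_convergence[OF cluster \<sigma>_lim[unfolded \<sigma>_def], of k\<^sub>1 "\<lambda>_. 0" 0 0] \<sigma>0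
      by (simp add: \<sigma>_def[abs_def])
  next
    case False
    then have v_gt: "w < v k" for k by (simp add: not_le)
    \<comment> \<open>A step from the unit ball around \<open>c\<close> that is no longer than 1 ends in the ball of radius 2.\<close>
    define A where "A = {z. fst z \<in> D \<inter> cball c 1 \<and> \<mu>\<^sub>0 \<le> fst (snd z) \<and> fst (snd z) \<le> M \<and>
     snd (snd z) \<in> cball c 2 \<and> model_minimizer (fst z) (fst (snd z)) (snd (snd z))}"
    define V where "V z = model (fst z) (fst (snd z)) (snd (snd z))" for z :: "(real^'n) \<times> real \<times> (real^'n)"
    define \<rho> where "\<rho> z = norm (snd (snd z) - fst z)" for z :: "(real^'n) \<times> real \<times> (real^'n)"
    have M0: "M \<ge> 0" using M(1) \<mu>\<^sub>0 by simp
    obtain C where C: "C \<ge> 0"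
      "\<And>x \<mu> y x' \<mu>' y' e. x \<in> cball c 1 \<Longrightarrow> x' \<in> cball c 1 \<Longrightarrow> y \<in> D \<inter> cball c 2 \<Longrightarrow> 0 \<le> \<mu> \<Longrightarrow>
        0 \<le> \<mu>' \<Longrightarrow> \<mu>' \<le> M \<Longrightarrow> model_minimizer x' \<mu>' y' \<Longrightarrow> norm (x' - x) \<le> e \<Longrightarrow> \<bar>\<mu>' - \<mu>\<bar> \<le> e \<Longrightarrow>
        model x' \<mu>' y' - model x \<mu> y \<le> C * (norm (y - x) * e + e\<^sup>2)"
      by (rule model_slope[OF M0, of c]) (rule that; blast)
    have slope: "V z' - V z \<le> C * (\<rho> z * norm (z' - z) + (norm (z' - z))\<^sup>2)" if "z \<in> A" "z' \<in> A" for z z'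
    proof -
      have "norm (fst (z' - z)) \<le> norm (z' - z)" by (rule norm_components_le)
      moreover have "norm (fst (snd (z' - z))) \<le> norm (z' - z)"
        by (rule order_trans[OF norm_components_le(1) norm_components_le(2)])
      ultimately show ?thesis
        unfolding V_def \<rho>_def using that \<mu>\<^sub>0 by (intro C(2)) (simp_all add: A_def model_minimizer_def)
    qed
    have A: "compact A" "definable_set S A"
      unfolding A_def by (rule compact_model_minimizers, rule definable_model_minimizers[OF assms(1-4)])
    have V: "definable_map V" "continuous_on UNIV V"
      unfolding V_def
      by (rule definable_model[OF assms(1-3)]) (intro continuous_on_model continuous_intros)
    have \<rho>: "definable_map \<rho>" "continuous_on UNIV \<rho>"
      unfolding \<rho>_def by (intro definable_intros definable_map_norm) (intro continuous_intros)
    have "(\<exists>b>w. \<exists>m>0. \<forall>z\<in>A. w < V z \<and> V z < b \<longrightarrow> m \<le> \<rho> z) \<or>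
      (\<exists>b>w. \<exists>s B. mono_on {w<..<b} s \<and> (\<forall>r. \<bar>s r\<bar> \<le> B) \<and>
        (\<forall>z\<in>A. \<forall>r. w < r \<and> r \<le> V z \<and> V z < b \<longrightarrow> V z - r \<le> C * \<rho> z * (s (V z) - s r)))"
      by (rule definable_desingularization[OF A V \<rho> _ C(1) slope]) (simp_all add: \<rho>_def)
    moreover
    have in_A: "(x k, \<mu> k, x (Suc k)) \<in> A" if "x k \<in> cball c 1" "\<sigma> k \<le> 1" for k
    proof -
      have "dist c (x (Suc k)) \<le> dist c (x k) + \<sigma> k"
        using dist_triangle[of c "x (Suc k)" "x k"] by (simp add: \<sigma>_def dist_norm norm_minus_commute)
      then show ?thesis using that it(1-3) M(2) by (auto simp: A_def)
    qed
    have V_x: "V (x k, \<mu> k, x (Suc k)) = v k" and \<rho>_x: "\<rho> (x k, \<mu> k, x (Suc k)) = \<sigma> k" for k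
      by (simp_all add: V_def v_def \<rho>_def \<sigma>_def)
    ultimately consider
      b m where "b > w" "m > 0" "\<And>z. z \<in> A \<Longrightarrow> w < V z \<Longrightarrow> V z < b \<Longrightarrow> m \<le> \<rho> z"
      | b s B where "b > w" "mono_on {w<..<b} s" "\<And>r. \<bar>s r\<bar> \<le> B"
        "\<And>z r. z \<in> A \<Longrightarrow> w < r \<Longrightarrow> r \<le> V z \<Longrightarrow> V z < b \<Longrightarrow> V z - r \<le> C * \<rho> z * (s (V z) - s r)"
      by (elim disjE exE conjE) blast+
    then show ?thesis
    proof cases
      case 1
      have "\<forall>\<^sub>F n in sequentially. x (r n) \<in> cball c 1 \<and> \<sigma> (r n) < min 1 m \<and> v (r n) < b"
      proof (intro eventually_conj)
        have "\<forall>\<^sub>F n in sequentially. dist (x (r n)) c < 1"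
          using tendstoD[OF cluster(2), of 1] by simp
        then show "\<forall>\<^sub>F n in sequentially. x (r n) \<in> cball c 1"
          by (rule eventually_mono) (simp add: dist_commute)
        show "\<forall>\<^sub>F n in sequentially. \<sigma> (r n) < min 1 m"
          by (rule order_tendstoD(2)[OF LIMSEQ_subseq_LIMSEQ[OF \<sigma>_lim cluster(1), unfolded o_def]])
            (use 1(2) in simp)
        show "\<forall>\<^sub>F n in sequentially. v (r n) < b"
          by (rule order_tendstoD(2)[OF LIMSEQ_subseq_LIMSEQ[OF v_lim cluster(1), unfolded o_def] 1(1)])
      qed
      then obtain n where n: "x (r n) \<in> cball c 1" "\<sigma> (r n) < min 1 m" "v (r n) < b"
        using eventually_happens'[OF sequentially_bot] by blast
      then have "m \<le> \<sigma> (r n)"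
        using 1(3)[OF in_A[of "r n"]] v_gt[of "r n"] by (simp add: V_x \<rho>_x)
      then show ?thesis using n(2) by simp
    next
      case 2
      have "\<forall>\<^sub>F k in sequentially. \<sigma> k < 1 \<and> v k < b"
        by (intro eventually_conj order_tendstoD(2)[OF \<sigma>_lim] order_tendstoD(2)[OF v_lim]) (use 2(1) in auto)
      then obtain k\<^sub>1 where k\<^sub>1: "\<And>k. k \<ge> k\<^sub>1 \<Longrightarrow> \<sigma> k < 1 \<and> v k < b"
        unfolding eventually_sequentially by blast
      have dec: "s (v (Suc k)) \<le> s (v k)" if "k \<ge> k\<^sub>1" for k
      proof -
        have "v k \<in> {w<..<b}" using v_gt k\<^sub>1[OF that] by simp
        moreover have "v (Suc k) \<in> {w<..<b}" using v_gt k\<^sub>1[of "Suc k"] that by simp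
        ultimately show ?thesis using mono_onD[OF 2(2), of "v (Suc k)" "v k"] v_dec by blast
      qed
      have descent: "(norm (x (Suc (Suc k)) - x (Suc k)))\<^sup>2 \<le> 4 / \<mu>\<^sub>0 * C * norm (x (Suc k) - x k) * (s (v k) - s (v (Suc k)))"
        if k: "k \<ge> k\<^sub>1" "x k \<in> cball c 1" for k
      proof -
        have "\<sigma> k \<le> 1" using k\<^sub>1[OF k(1)] by simp
        from 2(4)[OF in_A[OF k(2) this], of "v (Suc k)"]
        have "v k - v (Suc k) \<le> C * \<sigma> k * (s (v k) - s (v (Suc k)))"
          using k\<^sub>1[OF k(1)] v_gt[of "Suc k"] v_dec[of k] by (simp add: V_x \<rho>_x)
        then have "h (Suc k) - v (Suc k) \<le> C * \<sigma> k * (s (v k) - s (v (Suc k)))"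
          using hv[of k] by linarith
        then have "4 / \<mu>\<^sub>0 * (h (Suc k) - v (Suc k)) \<le> 4 / \<mu>\<^sub>0 * (C * \<sigma> k * (s (v k) - s (v (Suc k))))"
          using \<mu>\<^sub>0 by (intro mult_left_mono) auto
        then show ?thesis using \<sigma>_sq[of "Suc k"] by (simp add: \<sigma>_def mult_ac)
      qed
      have K: "0 \<le> 4 / \<mu>\<^sub>0 * C" using \<mu>\<^sub>0 C(1) by simp
      show ?thesis
        using finite_length_convergence[OF cluster \<sigma>_lim[unfolded \<sigma>_def], of k\<^sub>1 "\<lambda>k. s (v k)" B,
            OF dec 2(3) K descent]
        by (simp add: \<sigma>_def[abs_def])
    qed
  qed
  then have x_lim: "x \<longlonglongrightarrow> c" by blast
  have "\<forall>\<^sub>F k in sequentially. dist (x k) c < 1" using tendstoD[OF x_lim, of 1] by simp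
  then obtain k\<^sub>0 where k\<^sub>0: "\<And>k. k \<ge> k\<^sub>0 \<Longrightarrow> dist (x k) c < 1"
    unfolding eventually_sequentially by blast
  have \<mu>_le: "\<mu> k \<le> M" if "k \<ge> k\<^sub>0" for k
    using k\<^sub>0[OF that] by (intro M(2)) (simp add: dist_commute)
  have "range \<mu> \<subseteq> \<mu> ` {..<k\<^sub>0} \<union> {\<mu>\<^sub>0..M}"
  proof (rule image_subsetI)
    fix k show "\<mu> k \<in> \<mu> ` {..<k\<^sub>0} \<union> {\<mu>\<^sub>0..M}"
      using \<mu>_le[of k] it(2)[of k] by (cases "k < k\<^sub>0") auto
  qed
  moreover have "bounded (\<mu> ` {..<k\<^sub>0} \<union> {\<mu>\<^sub>0..M})"
    by (simp add: finite_imp_bounded bounded_closed_interval)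
  ultimately have "bounded (range \<mu>)" by (rule bounded_subset[rotated])
  \<comment> \<open>The models with the largest parameter \<open>M\<close> majorize those of the algorithm, so the limit can be taken
    at a constant parameter.\<close>
  moreover have "model_minimizer c M c"
    unfolding model_minimizer_def
  proof (intro conjI c ballI)
    fix y assume y: "y \<in> D"
    have "continuous_on UNIV (\<lambda>z. model z M y)" by (intro continuous_on_model continuous_intros)
    then have "isCont (\<lambda>z. model z M y) c" by (simp add: continuous_on_eq_continuous_at)
    from isCont_tendsto_compose[OF this x_lim] have "(\<lambda>k. model (x k) M y) \<longlonglongrightarrow> model c M y" .
    moreover have "h (Suc k) \<le> model (x k) M y" if "k \<ge> k\<^sub>0" for k
    proof -
      have "h (Suc k) \<le> model (x k) (\<mu> k) y"
        using hv[of k] it(3)[of k] y unfolding v_def model_minimizer_def by (meson order_trans)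
      also have "\<dots> \<le> model (x k) M y"
        using \<mu>_le[OF that] unfolding gn_model_def by (intro add_left_mono mult_right_mono) auto
      finally show ?thesis .
    qed
    ultimately have "w \<le> model c M y" using h_lim' by (intro LIMSEQ_le[of "\<lambda>k. h (Suc k)"]) auto
    then show "model c M c \<le> model c M y" by (simp add: model_self w_def)
  qed
  then have "critical_point F g D c" by (rule critical_point_if_model_minimizer)
  ultimately show ?thesis using finite_length by (simp add: \<sigma>_def[abs_def])
qed

end

theorem theorem2p2:
  fixes F :: "real^'n \<Rightarrow> real^'m"
    and g :: "real^'m \<Rightarrow> real"
    and D :: "(real^'n) set"
    and S :: "nat \<Rightarrow> real list set set"
    and x\<^sub>0 :: "real^'n" and \<mu>\<^sub>0 \<tau> :: real
    and x :: "nat \<Rightarrow> real^'n" and \<mu> :: "nat \<Rightarrow> real"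
  assumes "C2 F"
    and "convex_on UNIV g"
    and "convex D" and "closed D"
    and "o_minimal_structure S"
    and "definable_fun S F" and "definable_fun S g" and "definable_set S D"
    and "x\<^sub>0 \<in> D" and "\<mu>\<^sub>0 > 0" and "\<tau> > 1"
    and "gauss_newton_sequences F g D \<mu>\<^sub>0 \<tau> x\<^sub>0 x \<mu>"
  shows "filterlim (\<lambda>k. norm (x k)) at_top sequentially \<or>
         (\<exists>l. x \<longlonglongrightarrow> l \<and> critical_point F g D l) \<and>
         summable (\<lambda>k. norm (x (Suc k) - x k)) \<and>
         bounded (range \<mu>)"
proof (cases "filterlim (\<lambda>k. norm (x k)) at_top sequentially")
  case False
  interpret composite_problem F g D using assms(1-4) by unfold_locales
  from False obtain R where "\<not> (\<forall>\<^sub>F k in sequentially. R \<le> norm (x k))"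
    unfolding filterlim_at_top by blast
  then have "\<not> finite {k. \<not> R \<le> norm (x k)}"
    unfolding eventually_cofinite[symmetric] cofinite_eq_sequentially .
  then obtain r :: "nat \<Rightarrow> nat" where r: "strict_mono r" "\<And>n. \<not> R \<le> norm (x (r n))"
    using infinite_enumerate by blast
  have "\<forall>n. (x \<circ> r) n \<in> cball 0 R" using r(2) by (auto simp: not_le less_imp_le)
  then obtain c r' where r': "strict_mono r'" "((x \<circ> r) \<circ> r') \<longlonglongrightarrow> c"
    using compact_cball[of "0 :: real^'n" R] unfolding compact_def by blast
  have "strict_mono (r \<circ> r')" using r(1) r'(1) by (rule strict_mono_o)
  moreover have "(x \<circ> (r \<circ> r')) \<longlonglongrightarrow> c" using r'(2) by (simp add: o_assoc)
  ultimately show ?thesis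
    using convergence_to_cluster_point[OF assms(5-8,10,11,9,12)] by blast
qed simp

end
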